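(* Let $n\ge 2$, let $m\ge 1$, let $\mathbf{w_a}=\mathcal B(j_1,i_1)\mathcal B(j_2,i_2)\cdots\mathcal B(j_m,i_m)$ be an affine block of affine length $m$, let $w_a$ be the corresponding element of $W(\tilde A_n)$, and let $s\in S_n$. Then: (1) either $sw_a$ is not of minimal length in its coset $sw_aW(A_n)$, and then $l(sw_a)=l(w_a)+1$ and $sw_a=w_a\sigma_v$ for some $v$, $1\le v\le n$; (2) or $sw_a$ has minimal length in its coset $sw_aW(A_n)$ and one of the following holds: (a) $s=a_{n+1}$ and $h(j_1,i_1)=1$, so that $a_{n+1}w_a$ reduces to the affine block $\mathcal B(j_2,i_2)\cdots\mathcal B(j_m,i_m)$ (to $1$ if $m=1$); (b) $s=a_{n+1}$ and $h(j_1,i_1)$ is extremal, so that $a_{n+1}w_a$ is expressed by the affine block $a_{n+1}\mathcal B(j_1,i_1)\mathcal B(j_2,i_2)\cdots\mathcal B(j_m,i_m)$; (c) otherwise, $sw_a$ is expressed by an affine block of the form $\mathcal B(j'_1,i'_1)\mathcal B(j'_2,i'_2)\cdots\mathcal B(j'_m,i'_m)$, where the $2m$-tuples $(j_1,i_1,\dots,j_m,i_m)$ and $(j'_1,i'_1,\dots,j'_m,i'_m)$ differ in one and only one entry, say $j'_r\ne j_r$ or $i'_r\ne i_r$. If $l(sw_a)=l(w_a)+1$, then $j'_r=j_r-1$ or $i'_r=i_r+1$; if $l(sw_a)=l(w_a)-1$, then $j'_r=j_r+1$ or $i'_r=i_r-1$.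
   Context: $W(\tilde A_n)$ ($n\ge 2$) is the affine Coxeter group of type $\tilde A_n$ with generators $S_n=\{\sigma_1,\dots,\sigma_n,a_{n+1}\}$ whose Coxeter diagram is the $(n+1)$-cycle $\sigma_1-\sigma_2-\cdots-\sigma_n-a_{n+1}-\sigma_1$ (all edges of order 3). $W(A_n)$ is the parabolic subgroup generated by $\sigma_1,\dots,\sigma_n$. $l$ is the Coxeter length. Notation: $\lfloor i,j\rfloor=\sigma_i\sigma_{i+1}\cdots\sigma_j$ for $1\le i\le j\le n$, and $\lfloor n+1,n\rfloor=1$; $\lceil i,j\rceil=\sigma_i\sigma_{i-1}\cdots\sigma_j$ for $1\le j\le i\le n$, and $\lceil 0,1\rceil=1$; $h(r,i)=\lfloor r,n\rfloor\lceil i,1\rceil$ and $\mathcal B(r,i)=h(r,i)\,a_{n+1}$ for $0\le i\le n-1$, $1\le r\le n+1$. In particular $a_{n+1}=\mathcal B(n+1,0)$. An element of $W(A_n)$ is extremal if both $\sigma_1$ and $\sigma_n$ occur in its reduced expressions. An affine block of affine length $m\ge 1$ is an expression $\mathcal B(j_1,i_1)\cdots\mathcal B(j_m,i_m)$ where the family of integers $(j_s,i_s)_{1\le s\le m}$ satisfies the pairwise inequalities: (1) $1\le j_1\le n+1$ and $0\le i_1\le n-1$; (2) for $2\le s\le m$, either $i_s=0$ and $j_s=1$, or $1\le i_s\le n-1$ and $1\le j_s\le n$; (3) for $2\le s\le m$, $j_s\le j_{s-1}$ and $i_s\ge i_{s-1}$; (4) for $2\le s\le m$, if $j_{s-1}>i_{s-1}+1$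 then $j_s<j_{s-1}$; (5) for $2\le s\le m$, if $j_s>i_s+1$ then $i_s>i_{s-1}$. *)

theory Defs
  imports "HOL-Algebra.Coset" "HOL-Algebra.Generated_Groups"
begin

section \<open>Coxeter groups by generators and relations\<close>

text \<open>
  \<open>M s t\<close> is the order prescribed for \<open>st\<close>. The convention \<open>M s t = 0\<close> for an infinite order
  needs no special treatment, since the corresponding relation is then \<open>[] = []\<close>. Because
  \<open>M s s = 1\<close> makes every generator an involution, the monoid presented by these relations
  is the Coxeter group, and words need no formal inverses.
\<close>

inductive cox_eq :: "'s set \<Rightarrow> ('s \<Rightarrow> 's \<Rightarrow> nat) \<Rightarrow> 's list \<Rightarrow> 's list \<Rightarrow> bool"
  for S :: "'s set" and M :: "'s \<Rightarrow> 's \<Rightarrow> nat"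
where
  cox_rel: "s \<in> S \<Longrightarrow> t \<in> S \<Longrightarrow> cox_eq S M (concat (replicate (M s t) [s, t])) []"
| cox_refl: "u \<in> lists S \<Longrightarrow> cox_eq S M u u"
| cox_sym: "cox_eq S M u v \<Longrightarrow> cox_eq S M v u"
| cox_trans: "cox_eq S M u v \<Longrightarrow> cox_eq S M v w \<Longrightarrow> cox_eq S M u w"
| cox_cong: "cox_eq S M u u' \<Longrightarrow> cox_eq S M v v' \<Longrightarrow> cox_eq S M (u @ v) (u' @ v')"

definition cox_elem :: "'s set \<Rightarrow> ('s \<Rightarrow> 's \<Rightarrow> nat) \<Rightarrow> 's list \<Rightarrow> 's list set" where
  "cox_elem S M u = {v. cox_eq S M u v}"

definition cox_group :: "'s set \<Rightarrow> ('s \<Rightarrow> 's \<Rightarrow> nat) \<Rightarrow> 's list set monoid" where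
  "cox_group S M =
     \<lparr> carrier = lists S // {(u, v). cox_eq S M u v},
       monoid.mult = (\<lambda>X Y. {w. \<exists>u\<in>X. \<exists>v\<in>Y. cox_eq S M (u @ v) w}),
       one = cox_elem S M [] \<rparr>"

definition cox_length :: "'s set \<Rightarrow> ('s \<Rightarrow> 's \<Rightarrow> nat) \<Rightarrow> 's list set \<Rightarrow> nat" where
  "cox_length S M w = (LEAST k. \<exists>u\<in>lists S. cox_elem S M u = w \<and> length u = k)"

definition reduced_expr ::
    "'s set \<Rightarrow> ('s \<Rightarrow> 's \<Rightarrow> nat) \<Rightarrow> 's list \<Rightarrow> 's list set \<Rightarrow> bool" where
  "reduced_expr S M u w \<longleftrightarrow>
     u \<in> lists S \<and> cox_elem S M u = w \<and> length u = cox_length S M w"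

lemma cox_eq_lists: "cox_eq S M u v \<Longrightarrow> u \<in> lists S \<and> v \<in> lists S"
  by (induction rule: cox_eq.induct) (auto split: if_splits)

lemma cox_elem_eq_iff:
  assumes "u \<in> lists S"
  shows "cox_elem S M u = cox_elem S M v \<longleftrightarrow> cox_eq S M u v"
  unfolding cox_elem_def using assms
  by (auto intro: cox_refl cox_sym cox_trans)

lemma carrier_cox_group: "carrier (cox_group S M) = cox_elem S M ` lists S"
  by (auto simp: cox_group_def cox_elem_def quotient_def)

lemma one_cox_group: "\<one>\<^bsub>cox_group S M\<^esub> = cox_elem S M []"
  by (simp add: cox_group_def)

lemma mult_cox_elem:
  assumes "u \<in> lists S" "v \<in> lists S"
  shows "cox_elem S M u \<otimes>\<^bsub>cox_group S M\<^esub> cox_elem S M v = cox_elem S M (u @ v)"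
  using assms unfolding cox_group_def cox_elem_def
  by (auto intro: cox_refl cox_trans cox_cong)

lemma cox_eq_rev:
  assumes "\<And>s. s \<in> S \<Longrightarrow> M s s = 1" and "u \<in> lists S"
  shows "cox_eq S M (rev u @ u) []"
  using assms(2)
proof (induction u rule: lists.induct)
  case Nil
  then show ?case by (simp add: cox_refl)
next
  case (Cons s u)
  then have s: "s \<in> S" and u: "u \<in> lists S" by auto
  have "cox_eq S M [s, s] []"
    using cox_rel[where M = M, OF s s] unfolding assms(1)[OF s] by simp
  then have 1: "cox_eq S M ([s, s] @ u) ([] @ u)"
    by (rule cox_cong) (rule cox_refl[OF u])
  have "rev u \<in> lists S" using u by auto
  then have "cox_eq S M (rev u @ [s, s] @ u) (rev u @ [] @ u)"
    by (rule cox_cong[OF cox_refl 1])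
  then have "cox_eq S M (rev (s # u) @ s # u) (rev u @ u)" by simp
  then show ?case
    using Cons.IH by (rule cox_trans)
qed

lemma group_cox_group:
  assumes "\<And>s. s \<in> S \<Longrightarrow> M s s = 1"
  shows "group (cox_group S M)"
proof (rule groupI)
  fix x assume "x \<in> carrier (cox_group S M)"
  then obtain u where u: "u \<in> lists S" and x: "x = cox_elem S M u"
    unfolding carrier_cox_group by blast
  have r: "rev u \<in> lists S" using u by auto
  have "cox_eq S M (rev u @ u) []"
    using assms u by (rule cox_eq_rev)
  then have "cox_elem S M (rev u) \<otimes>\<^bsub>cox_group S M\<^esub> x = \<one>\<^bsub>cox_group S M\<^esub>"
    unfolding x mult_cox_elem[OF r u] one_cox_group
    by (subst cox_elem_eq_iff) (use u r in auto)
  with r show "\<exists>y\<in>carrier (cox_group S M). y \<otimes>\<^bsub>cox_group S M\<^esub> x = \<one>\<^bsub>cox_group S M\<^esub>"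
    unfolding carrier_cox_group by blast
  show "\<one>\<^bsub>cox_group S M\<^esub> \<otimes>\<^bsub>cox_group S M\<^esub> x = x"
    unfolding x one_cox_group by (subst mult_cox_elem) (use u in auto)
next
  fix x y assume "x \<in> carrier (cox_group S M)" "y \<in> carrier (cox_group S M)"
  then obtain u v where u: "u \<in> lists S" "x = cox_elem S M u"
    and v: "v \<in> lists S" "y = cox_elem S M v"
    unfolding carrier_cox_group by blast
  then have "u @ v \<in> lists S" by simp
  then show "x \<otimes>\<^bsub>cox_group S M\<^esub> y \<in> carrier (cox_group S M)"
    unfolding u(2) v(2) mult_cox_elem[OF u(1) v(1)] carrier_cox_group by (rule imageI)
  fix z assume "z \<in> carrier (cox_group S M)"
  then obtain t where t: "t \<in> lists S" "z = cox_elem S M t"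
    unfolding carrier_cox_group by blast
  have "u @ v \<in> lists S" "v @ t \<in> lists S" using u v t by auto
  then show "x \<otimes>\<^bsub>cox_group S M\<^esub> y \<otimes>\<^bsub>cox_group S M\<^esub> z = x \<otimes>\<^bsub>cox_group S M\<^esub> (y \<otimes>\<^bsub>cox_group S M\<^esub> z)"
    using u v t by (simp only: mult_cox_elem append_assoc)
next
  show "\<one>\<^bsub>cox_group S M\<^esub> \<in> carrier (cox_group S M)"
    unfolding carrier_cox_group one_cox_group by (rule imageI) simp
qed


section \<open>The affine group of type \<open>A\<close>\<close>

text \<open>
  The generators are indexed by \<open>{1..n+1}\<close>: the letter \<open>i \<le> n\<close> stands for \<open>\<sigma>\<^sub>i\<close> and the letter
  \<open>n + 1\<close> for \<open>a\<^sub>n\<^sub>+\<^sub>1\<close>. The matrix below is meant for \<open>n \<ge> 2\<close>.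
\<close>

definition affA_matrix :: "nat \<Rightarrow> nat \<Rightarrow> nat \<Rightarrow> nat" where
  "affA_matrix n s t =
     (if s = t then 1
      else if t = s + 1 \<or> s = t + 1 \<or> {s, t} = {1, n + 1} then 3
      else 2)"

definition WA_aff :: "nat \<Rightarrow> nat list set monoid" where
  "WA_aff n = cox_group {1..n + 1} (affA_matrix n)"

definition word_elem :: "nat \<Rightarrow> nat list \<Rightarrow> nat list set" where
  "word_elem n u = cox_elem {1..n + 1} (affA_matrix n) u"

definition len :: "nat \<Rightarrow> nat list set \<Rightarrow> nat" where
  "len n w = cox_length {1..n + 1} (affA_matrix n) w"

definition \<sigma> :: "nat \<Rightarrow> nat \<Rightarrow> nat list set" where
  "\<sigma> n i = word_elem n [i]"

definition a_gen :: "nat \<Rightarrow> nat list set" where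
  "a_gen n = word_elem n [n + 1]"

definition gens :: "nat \<Rightarrow> nat list set set" where
  "gens n = \<sigma> n ` {1..n} \<union> {a_gen n}"

definition WA :: "nat \<Rightarrow> nat list set set" where
  "WA n = generate (WA_aff n) (\<sigma> n ` {1..n})"

lemma group_WA_aff: "group (WA_aff n)"
  unfolding WA_aff_def by (rule group_cox_group) (simp add: affA_matrix_def)

definition minimal_in_coset :: "nat \<Rightarrow> nat list set \<Rightarrow> bool" where
  "minimal_in_coset n w \<longleftrightarrow> (\<forall>x \<in> w <#\<^bsub>WA_aff n\<^esub> WA n. len n w \<le> len n x)"

definition extremal :: "nat \<Rightarrow> nat list set \<Rightarrow> bool" where
  "extremal n w \<longleftrightarrow> w \<in> WA n \<and>
     (\<forall>u. reduced_expr {1..n + 1} (affA_matrix n) u w \<longrightarrow> 1 \<in> set u \<and> n \<in> set u)"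


section \<open>Affine blocks\<close>

text \<open>
  \<open>up_word i j\<close> and \<open>down_word i j\<close> are the words \<open>\<lfloor>i,j\<rfloor>\<close> and \<open>\<lceil>i,j\<rceil>\<close>; the conventions
  \<open>\<lfloor>n+1,n\<rfloor> = 1\<close> and \<open>\<lceil>0,1\<rceil> = 1\<close> hold because the intervals are then empty.
\<close>

definition up_word :: "nat \<Rightarrow> nat \<Rightarrow> nat list" where
  "up_word i j = [i..<Suc j]"

definition down_word :: "nat \<Rightarrow> nat \<Rightarrow> nat list" where
  "down_word i j = rev [j..<Suc i]"

definition h_word :: "nat \<Rightarrow> nat \<Rightarrow> nat \<Rightarrow> nat list" where
  "h_word n r i = up_word r n @ down_word i 1"

definition B_word :: "nat \<Rightarrow> nat \<Rightarrow> nat \<Rightarrow> nat list" where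
  "B_word n r i = h_word n r i @ [n + 1]"

text \<open>
  The family \<open>(j\<^sub>s,i\<^sub>s)\<close>, \<open>1 \<le> s \<le> m\<close>, is the list \<open>[(j\<^sub>1,i\<^sub>1), \<dots>, (j\<^sub>m,i\<^sub>m)]\<close>. Lists are indexed
  from \<open>0\<close>, so the range \<open>2 \<le> s \<le> m\<close> becomes \<open>1 \<le> s < m\<close>.
\<close>

definition affine_block :: "nat \<Rightarrow> (nat \<times> nat) list \<Rightarrow> bool" where
  "affine_block n bs \<longleftrightarrow>
     bs \<noteq> [] \<and>
     (let j = (\<lambda>s. fst (bs ! s)); i = (\<lambda>s. snd (bs ! s)); m = length bs in
        1 \<le> j 0 \<and> j 0 \<le> n + 1 \<and> i 0 \<le> n - 1 \<and>
        (\<forall>s. 1 \<le> s \<and> s < m \<longrightarrow>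
           (i s = 0 \<and> j s = 1 \<or> 1 \<le> i s \<and> i s \<le> n - 1 \<and> 1 \<le> j s \<and> j s \<le> n) \<and>
           j s \<le> j (s - 1) \<and> i s \<ge> i (s - 1) \<and>
           (j (s - 1) > i (s - 1) + 1 \<longrightarrow> j s < j (s - 1)) \<and>
           (j s > i s + 1 \<longrightarrow> i s > i (s - 1))))"

definition block_word :: "nat \<Rightarrow> (nat \<times> nat) list \<Rightarrow> nat list" where
  "block_word n bs = concat (map (\<lambda>(j, i). B_word n j i) bs)"

definition block_elem :: "nat \<Rightarrow> (nat \<times> nat) list \<Rightarrow> nat list set" where
  "block_elem n bs = word_elem n (block_word n bs)"

end

theory Submission
  imports Defs
begin

text \<open>
  The proof follows the generator \<open>s\<close> through the block from left to right and uses only relations of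
  \<open>W(A\<^sub>n)\<close> and of the two paths that end in \<open>a\<close>. As a permutation, \<open>h(j,i)\<close> is
  determined by the images \<open>p\<close> of \<open>1\<close> and \<open>q = j\<close> of \<open>n + 1\<close>. A letter \<open>\<sigma>\<^sub>k\<close> in front of
  \<open>h(j,i)\<close> either moves \<open>p\<close> or \<open>q\<close> by one position, which changes exactly one of \<open>j\<close> and \<open>i\<close> by one, or it
  crosses \<open>h(j,i)\<close> and leaves as a letter that commutes with \<open>a\<close> and meets the next pair. The block
  conditions say that the \<open>p\<close> of successive pairs increase and their \<open>q\<close> decrease (strictly if
  \<open>p < q\<close>). So the change can spoil them only if the next pair is tight against the first one, and
  exactly then a relation \<open>\<sigma>\<^sub>k B B' = B B' \<sigma>\<^sub>n\<close> or \<open>\<sigma>\<^sub>k B B' = B B' \<sigma>\<^sub>1\<close> carries the letter past both pairs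
  (\<open>letter_passes_two_pairs_up\<close>, \<open>letter_passes_two_pairs_down\<close>). By induction the letter either changes one
  entry somewhere or leaves the whole block on the right (\<open>letter_outcome_generator\<close>). The affine
  letter cancels if \<open>h = 1\<close>, lengthens the block if \<open>h\<close> is extremal, and otherwise crosses the first pair and
  becomes \<open>\<sigma>\<^sub>1\<close> or \<open>\<sigma>\<^sub>n\<close> (\<open>affine_letter_outcome\<close>).

  For lengths and minimality, let the group act on integer vectors by affine reflections. Every letter
  changes the \<open>height\<close> of a vector, a count of separating hyperplanes, by at most one, so the height
  of the image of the origin bounds the length from below for all elements of a coset of
  \<open>W(A\<^sub>n)\<close>. Along a block word every letter raises the height by one (\<open>block_word_act\<close>). Hence
  block words are reduced and represent minimal elements of their cosets (\<open>len_block_word\<close>,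
  \<open>minimal_block\<close>). This separates the two alternatives of the theorem and determines the direction of the
  change of the entry.
\<close>

section \<open>Braid moves along paths of a Coxeter diagram\<close>

locale coxeter_matrix =
  fixes S :: "'s set" and M :: "'s \<Rightarrow> 's \<Rightarrow> nat"
  assumes M_diag: "s \<in> S \<Longrightarrow> M s s = 1"
    and M_sym: "M s t = M t s"
begin

abbreviation weq :: "'s list \<Rightarrow> 's list \<Rightarrow> bool" (infix "\<approx>" 50) where
  "u \<approx> v \<equiv> cox_eq S M u v"

lemmas [trans] = cox_trans[of S M]

lemma cong_mid:
  assumes "u \<approx> v" "set x \<subseteq> S" "set y \<subseteq> S"
  shows "x @ u @ y \<approx> x @ v @ y"
  using assms by (intro cox_cong cox_refl) (auto simp: lists_eq_set)

lemma cong_left: "u \<approx> v \<Longrightarrow> set x \<subseteq> S \<Longrightarrow> x @ u \<approx> x @ v"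
  using cong_mid[of u v x "[]"] by simp

lemma cong_right: "u \<approx> v \<Longrightarrow> set y \<subseteq> S \<Longrightarrow> u @ y \<approx> v @ y"
  using cong_mid[of u v "[]" y] by simp

lemma weq_refl: "set u \<subseteq> S \<Longrightarrow> u \<approx> u"
  by (rule cox_refl) (auto simp: lists_eq_set)

lemma weq_set: "u \<approx> v \<Longrightarrow> set u \<subseteq> S \<and> set v \<subseteq> S"
  using cox_eq_lists by (fastforce simp: lists_eq_set)

lemma square_eq_Nil: "s \<in> S \<Longrightarrow> [s, s] \<approx> []"
  using cox_eq_rev[of S M "[s]"] M_diag by simp

lemma eq_rev_of_product_eq_Nil:
  assumes "u @ v \<approx> []"
  shows "u \<approx> rev v"
proof -
  have s: "set u \<subseteq> S" "set v \<subseteq> S" using weq_set[OF assms] by auto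
  have "v @ rev v \<approx> []"
    using cox_eq_rev[of S M "rev v"] M_diag s by (auto simp: lists_eq_set)
  then have "u @ [] \<approx> u @ (v @ rev v)" using cong_left s cox_sym by blast
  also have "u @ (v @ rev v) \<approx> [] @ rev v"
    using cong_right[OF assms, of "rev v"] s by simp
  finally show ?thesis by simp
qed

lemma commute:
  assumes "s \<in> S" "t \<in> S" "M s t = 2"
  shows "[s, t] \<approx> [t, s]"
proof -
  have "[s, t] @ [s, t] \<approx> []"
    using cox_rel[of s S t M] assms by (simp add: numeral_2_eq_2)
  from eq_rev_of_product_eq_Nil[OF this] show ?thesis by simp
qed

lemma braid:
  assumes "s \<in> S" "t \<in> S" "M s t = 3"
  shows "[s, t, s] \<approx> [t, s, t]"
proof -
  have "[s, t, s] @ [t, s, t] \<approx> []"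
    using cox_rel[of s S t M] assms by (simp add: numeral_3_eq_3)
  from eq_rev_of_product_eq_Nil[OF this] show ?thesis by simp
qed

lemma commute_word:
  assumes "s \<in> S" "set u \<subseteq> S" "\<And>t. t \<in> set u \<Longrightarrow> M s t = 2"
  shows "[s] @ u \<approx> u @ [s]"
  using assms(2,3)
proof (induction u)
  case Nil
  then show ?case using assms(1) by (simp add: weq_refl)
next
  case (Cons t u)
  have "[s, t] @ u \<approx> [t, s] @ u"
    using Cons.prems assms(1) by (intro cong_right commute) auto
  also have "[t, s] @ u = [t] @ ([s] @ u)" by simp
  also have "\<dots> \<approx> [t] @ (u @ [s])"
    using Cons by (intro cong_left Cons.IH) auto
  finally show ?case by simp
qed

lemma commute_words:
  assumes "set u \<subseteq> S" "set v \<subseteq> S" "\<And>s t. s \<in> set u \<Longrightarrow> t \<in> set v \<Longrightarrow> M s t = 2"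
  shows "u @ v \<approx> v @ u"
  using assms(1,3)
proof (induction u)
  case Nil
  then show ?case using assms(2) by (simp add: weq_refl)
next
  case (Cons s u)
  have "[s] @ (u @ v) \<approx> [s] @ (v @ u)"
    using Cons by (intro cong_left Cons.IH) auto
  also have "[s] @ (v @ u) = ([s] @ v) @ u" by simp
  also have "\<dots> \<approx> (v @ [s]) @ u"
    using Cons.prems assms(2) by (intro cong_right commute_word) auto
  finally show ?case by simp
qed

text \<open>
  The letters form an induced path of the Coxeter diagram, met in this order: neighbours braid and
  all other pairs commute.
\<close>

definition path :: "'s list \<Rightarrow> bool" where
  "path u \<longleftrightarrow> set u \<subseteq> S \<and>
     (\<forall>i j. i < j \<and> j < length u \<longrightarrow> M (u ! i) (u ! j) = (if j = Suc i then 3 else 2))"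

text \<open>
  A Coxeter element of type A conjugates each generator to its neighbour. The letter
  \<open>u ! Suc i\<close> commutes with everything before \<open>u ! i\<close>, the braid relation turns
  \<open>u ! Suc i\<close>, \<open>u ! i\<close>, \<open>u ! Suc i\<close> into \<open>u ! i\<close>, \<open>u ! Suc i\<close>, \<open>u ! i\<close>, and the last \<open>u ! i\<close>
  commutes with the rest.
\<close>

lemma path_shift:
  assumes u: "path u" and i: "Suc i < length u"
  shows "[u ! Suc i] @ u \<approx> u @ [u ! i]"
proof -
  define x y b c where "x = take i u" and "y = drop (i + 2) u"
    and "b = u ! i" and "c = u ! Suc i"
  have u_eq: "u = x @ [b, c] @ y"
    using i unfolding x_def y_def b_def c_def
    by (metis Cons_nth_drop_Suc Suc_lessD add_2_eq_Suc' append_Cons append_Nil append_take_drop_id)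
  have S: "set x \<subseteq> S" "set y \<subseteq> S" "b \<in> S" "c \<in> S"
    using u unfolding path_def by (subst (asm) u_eq, auto)+
  have bc: "M c b = 3"
    using u i unfolding path_def b_def c_def by (subst M_sym) auto
  have cx: "M c t = 2" if "t \<in> set x" for t
  proof -
    obtain j where "j < i" "t = u ! j"
      using \<open>t \<in> set x\<close> i unfolding x_def by (auto simp: in_set_conv_nth)
    then show ?thesis using u i unfolding path_def c_def by (subst M_sym) auto
  qed
  have by': "M b t = 2" if "t \<in> set y" for t
  proof -
    obtain j where "j < length u - (i + 2)" "t = u ! (i + 2 + j)"
      using \<open>t \<in> set y\<close> i unfolding y_def by (auto simp: in_set_conv_nth)
    then show ?thesis using u i unfolding path_def b_def by auto
  qed
  have "([c] @ x) @ [b, c] @ y \<approx> (x @ [c]) @ [b, c] @ y"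
    using S cx by (intro cong_right commute_word) auto
  also have "(x @ [c]) @ [b, c] @ y = x @ [c, b, c] @ y" by simp
  also have "\<dots> \<approx> x @ [b, c, b] @ y"
    using S bc by (intro cong_mid braid) auto
  also have "\<dots> = (x @ [b, c]) @ ([b] @ y)" by simp
  also have "\<dots> \<approx> (x @ [b, c]) @ (y @ [b])"
    using S by' by (intro cong_left commute_word) auto
  finally show ?thesis
    unfolding b_def[symmetric] c_def[symmetric] by (subst (1 2) u_eq) simp
qed

lemma shift_word:
  assumes "list_all2 (\<lambda>b c. [b] @ u \<approx> u @ [c]) xs ys" "set u \<subseteq> S"
  shows "xs @ u \<approx> u @ ys"
  using assms(1)
proof (induction rule: list_all2_induct)
  case Nil
  then show ?case using assms(2) by (simp add: weq_refl)
next
  case (Cons b xs c ys)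
  have S: "b \<in> S" "set ys \<subseteq> S"
    using weq_set[OF Cons.hyps(1)] weq_set[OF Cons.IH] by auto
  have "[b] @ (xs @ u) \<approx> [b] @ (u @ ys)" using S by (intro cong_left Cons.IH) auto
  also have "[b] @ (u @ ys) = ([b] @ u) @ ys" by simp
  also have "\<dots> \<approx> (u @ [c]) @ ys" using S Cons.hyps(1) by (intro cong_right)
  finally show ?case by simp
qed

text \<open>
  All letters of the path but the first pass through it at once. Applied to a path that ends in the
  affine generator, this is the relation by which a letter crosses two adjacent pairs of a block.
\<close>

lemma path_shift_tl:
  assumes "path u"
  shows "tl u @ u \<approx> u @ butlast u"
proof (rule shift_word)
  show "list_all2 (\<lambda>b c. [b] @ u \<approx> u @ [c]) (tl u) (butlast u)"
    using path_shift[OF assms]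
    by (auto simp: list_all2_conv_all_nth nth_tl nth_butlast)
  show "set u \<subseteq> S" using assms by (simp add: path_def)
qed

end

section \<open>Words in the affine group of type A\<close>

lemma affA_matrix_eq:
  "affA_matrix n s t =
     (if s = t then 1
      else if t = s + 1 \<or> s = t + 1 \<or> s = 1 \<and> t = n + 1 \<or> s = n + 1 \<and> t = 1 then 3 else 2)"
  by (simp add: affA_matrix_def doubleton_eq_iff)

interpretation affA: coxeter_matrix "{1..n + 1}" "affA_matrix n" for n
  by unfold_locales (simp_all add: affA_matrix_eq, arith?)

abbreviation affA_eq :: "nat list \<Rightarrow> nat \<Rightarrow> nat list \<Rightarrow> bool" ("_ \<approx>\<^bsub>_\<^esub> _" [51, 0, 51] 50) where
  "u \<approx>\<^bsub>n\<^esub> v \<equiv> cox_eq {1..n + 1} (affA_matrix n) u v"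

lemma set_up_word [simp]: "set (up_word i j) = {i..j}"
  by (auto simp: up_word_def)

lemma set_down_word [simp]: "set (down_word i j) = {j..i}"
  by (auto simp: down_word_def)

lemma length_up_word [simp]: "length (up_word i j) = Suc j - i"
  by (simp add: up_word_def del: upt_Suc)

lemma length_down_word [simp]: "length (down_word i j) = Suc i - j"
  by (simp add: down_word_def del: upt_Suc)

lemma nth_up_word: "k < Suc j - i \<Longrightarrow> up_word i j ! k = i + k"
  by (simp add: up_word_def del: upt_Suc)

lemma nth_down_word: "k < Suc i - j \<Longrightarrow> down_word i j ! k = i - k"
  by (auto simp: down_word_def rev_nth simp del: upt_Suc)

lemma up_word_Cons: "i \<le> j \<Longrightarrow> up_word i j = i # up_word (Suc i) j"
  by (simp add: up_word_def upt_conv_Cons del: upt_Suc)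

lemma up_word_Nil [simp]: "j < i \<Longrightarrow> up_word i j = []"
  by (simp add: up_word_def)

lemma down_word_Cons: "j \<le> Suc i \<Longrightarrow> down_word (Suc i) j = Suc i # down_word i j"
  by (simp add: down_word_def)

lemma down_word_Nil [simp]: "i < j \<Longrightarrow> down_word i j = []"
  by (simp add: down_word_def)

lemma path_up_word_general:
  assumes "1 \<le> j" "k \<le> n + 1" "2 \<le> j \<or> k \<le> n"
  shows "affA.path n (up_word j k)"
  unfolding affA.path_def
proof (intro conjI allI impI)
  show "set (up_word j k) \<subseteq> {1..n + 1}" using assms by simp
  fix a b assume ab: "a < b \<and> b < length (up_word j k)"
  then have "up_word j k ! a = j + a" "up_word j k ! b = j + b" "j + b \<le> k"
    by (auto simp: nth_up_word)
  moreover have "\<not> (j + a = 1 \<and> j + b = n + 1)"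
    using assms \<open>j + b \<le> k\<close> by linarith
  ultimately show "affA_matrix n (up_word j k ! a) (up_word j k ! b) = (if b = Suc a then 3 else 2)"
    using ab assms(1) by (auto simp: affA_matrix_eq)
qed

lemma path_up_word: "1 \<le> j \<Longrightarrow> affA.path n (up_word j n)"
  by (rule path_up_word_general) auto

lemma path_up_word_affine:
  assumes "2 \<le> j" "j \<le> n + 1"
  shows "affA.path n (up_word j n @ [n + 1])"
proof -
  have "up_word j n @ [n + 1] = up_word j (n + 1)"
    using assms by (simp add: up_word_def)
  then show ?thesis using path_up_word_general[of j "n + 1" n] assms by simp
qed

lemma path_down_word:
  assumes "i \<le> n"
  shows "affA.path n (down_word i 1)"
  unfolding affA.path_def
proof (intro conjI allI impI)
  show "set (down_word i 1) \<subseteq> {1..n + 1}" using assms by simp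
  fix a b assume ab: "a < b \<and> b < length (down_word i 1)"
  then have "b < i" by simp
  then have "down_word i 1 ! a = i - a" "down_word i 1 ! b = i - b"
    using ab by (simp_all add: nth_down_word)
  moreover have "i - a \<noteq> i - b" "i - b \<noteq> i - a + 1" "(i - a = i - b + 1) = (b = Suc a)"
    "i - a \<noteq> n + 1" "i - b \<noteq> n + 1"
    using ab \<open>b < i\<close> assms by linarith+
  ultimately show "affA_matrix n (down_word i 1 ! a) (down_word i 1 ! b) = (if b = Suc a then 3 else 2)"
    by (simp only: affA_matrix_eq) simp
qed

lemma path_down_word_affine:
  assumes "i < n"
  shows "affA.path n (down_word i 1 @ [n + 1])"
  unfolding affA.path_def
proof (intro conjI allI impI)
  let ?u = "down_word i 1 @ [n + 1]"
  show "set ?u \<subseteq> {1..n + 1}" using assms by simp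
  fix a b assume ab: "a < b \<and> b < length ?u"
  then have a: "?u ! a = i - a" "1 \<le> i - a" by (auto simp: nth_append nth_down_word)
  show "affA_matrix n (?u ! a) (?u ! b) = (if b = Suc a then 3 else 2)"
  proof (cases "b = i")
    case True
    then have "?u ! b = n + 1" "i - a \<noteq> n + 1" "n + 1 \<noteq> i - a + 1" "i - a \<noteq> n + 1 + 1"
      "(i - a = 1) = (b = Suc a)"
      using ab assms by (auto simp: nth_append)
    then show ?thesis using a assms by (simp only: affA_matrix_eq) simp
  next
    case False
    then have b: "?u ! b = down_word i 1 ! b" "?u ! a = down_word i 1 ! a" 
      using ab by (auto simp: nth_append)
    have "a < b \<and> b < length (down_word i 1)" using False ab by auto
    then show ?thesis
      using path_down_word[of i n] assms unfolding affA.path_def b by simp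
  qed
qed

lemma up_word_shift:
  assumes "1 \<le> j" "j < k" "k \<le> n"
  shows "[k] @ up_word j n \<approx>\<^bsub>n\<^esub> up_word j n @ [k - 1]"
  using affA.path_shift[OF path_up_word, of j "k - 1 - j" n] assms by (simp add: nth_up_word)

lemma down_word_shift:
  assumes "1 \<le> k" "k < i" "i \<le> n"
  shows "[k] @ down_word i 1 \<approx>\<^bsub>n\<^esub> down_word i 1 @ [Suc k]"
  using affA.path_shift[OF path_down_word, of i n "i - Suc k"] assms
  by (simp add: nth_down_word Suc_diff_Suc)

lemma far_up_word:
  assumes "1 \<le> k" "k + 1 < j"  "j \<le> n + 1"
  shows "[k] @ up_word j n \<approx>\<^bsub>n\<^esub> up_word j n @ [k]"
  using assms by (intro affA.commute_word) (auto simp: affA_matrix_eq)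

lemma far_down_word:
  assumes "i + 1 < k" "k \<le> n"
  shows "[k] @ down_word i 1 \<approx>\<^bsub>n\<^esub> down_word i 1 @ [k]"
  using assms by (intro affA.commute_word) (auto simp: affA_matrix_eq)

text \<open>
  The two factors of \<open>h(j,i)\<close> can always be interchanged: they commute when they do not meet, and
  otherwise the letters of the second pass through the first and are raised by one. The reversed
  form brings \<open>\<lceil>l,1\<rceil>\<close> next to a preceding \<open>\<lceil>l,1\<rceil> a\<close>, where \<open>path_shift_tl\<close> applies.
\<close>

lemma h_word_swap_disjoint:
  assumes "1 \<le> j" "i + 1 < j" "j \<le> n + 1"
  shows "h_word n j i \<approx>\<^bsub>n\<^esub> down_word i 1 @ up_word j n"
  unfolding h_word_def using assms
  by (intro affA.commute_words) (auto simp: affA_matrix_eq)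

lemma h_word_swap_meet:
  assumes "1 \<le> j" "j \<le> i + 1" "i < n"
  shows "h_word n j i \<approx>\<^bsub>n\<^esub> down_word (i + 1) 1 @ up_word (j + 1) n"
proof -
  have "j - 1 \<le> i" using assms by simp
  then show ?thesis using assms(3)
  proof (induction i rule: dec_induct)
    case base
    have "[j] @ (up_word (j + 1) n @ down_word (j - 1) 1)
        \<approx>\<^bsub>n\<^esub> [j] @ (down_word (j - 1) 1 @ up_word (j + 1) n)"
      using assms
      by (intro affA.cong_left affA.commute_words) (auto simp: affA_matrix_eq)
    moreover have "down_word j 1 = j # down_word (j - 1) 1"
      using down_word_Cons[of 1 "j - 1"] assms by simp
    ultimately show ?case
      using assms by (simp add: h_word_def up_word_Cons[of j])
  next
    case (step i)
    have d: "down_word (Suc i) 1 = [Suc i] @ down_word i 1"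
      "down_word (Suc i + 1) 1 = [Suc (Suc i)] @ down_word (i + 1) 1"
      by (simp_all add: down_word_Cons)
    have "([Suc (Suc i)] @ up_word j n) @ down_word i 1 \<approx>\<^bsub>n\<^esub> (up_word j n @ [Suc i]) @ down_word i 1"
      using step assms up_word_shift[of j "Suc (Suc i)" n] by (intro affA.cong_right) auto
    then have "h_word n j (Suc i) \<approx>\<^bsub>n\<^esub> [Suc (Suc i)] @ h_word n j i"
      unfolding h_word_def d by (simp add: cox_sym)
    also have "\<dots> \<approx>\<^bsub>n\<^esub> [Suc (Suc i)] @ (down_word (i + 1) 1 @ up_word (j + 1) n)"
      using step by (intro affA.cong_left) auto
    finally show ?case unfolding d by simp
  qed
qed

section \<open>A generator in front of one or two pairs\<close>

text \<open>
  A block is checked locally: \<open>entry_ok\<close> is the condition on its first pair and \<open>next_ok\<close> the one on two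
  consecutive pairs. As a permutation of \<open>{1..n + 1}\<close>, the element \<open>h(j,i)\<close> sends \<open>n + 1\<close> to \<open>q = j\<close>,
  it sends \<open>1\<close> to \<open>p = i + 1\<close> if \<open>i + 1 < j\<close> and to \<open>p = i + 2\<close> otherwise, and it keeps the order of the
  other points. In these terms \<open>next_ok\<close> says \<open>p' \<noteq> 1\<close>, \<open>q' \<noteq> n + 1\<close>, \<open>p \<le> p'\<close> and \<open>q' \<le> q\<close>, where both
  inequalities are strict when \<open>p < q\<close>.
\<close>

definition entry_ok :: "nat \<Rightarrow> nat \<times> nat \<Rightarrow> bool" where
  "entry_ok n b \<longleftrightarrow> 1 \<le> fst b \<and> fst b \<le> n + 1 \<and> snd b \<le> n - 1"

definition next_ok :: "nat \<Rightarrow> nat \<times> nat \<Rightarrow> nat \<times> nat \<Rightarrow> bool" where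
  "next_ok n b b' \<longleftrightarrow>
     (snd b' = 0 \<and> fst b' = 1 \<or> 1 \<le> snd b' \<and> snd b' \<le> n - 1 \<and> 1 \<le> fst b' \<and> fst b' \<le> n) \<and>
     fst b' \<le> fst b \<and> snd b \<le> snd b' \<and>
     (snd b + 1 < fst b \<longrightarrow> fst b' < fst b) \<and>
     (snd b' + 1 < fst b' \<longrightarrow> snd b < snd b')"

text \<open>
  The letter \<open>k\<close>, if it is neither \<open>j\<close> nor \<open>j - 1\<close>, leaves the first factor \<open>\<lfloor>j,n\<rfloor>\<close> of \<open>h(j,i)\<close> as this letter.
\<close>

fun shifted_letter :: "nat \<Rightarrow> nat \<times> nat \<Rightarrow> nat" where
  "shifted_letter k (j, i) = (if k < j then k else k - 1)"

text \<open>
  The pair of \<open>\<sigma>\<^sub>k h(j,i)\<close>, up to a generator on the right: the transposition of \<open>k\<close> and \<open>k + 1\<close> is applied to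
  the images of \<open>1\<close> and \<open>n + 1\<close>. If neither is affected, the pair is unchanged, and \<open>\<sigma>\<^sub>k\<close> leaves
  \<open>h(j,i)\<close> on the right as \<open>passed_letter\<close>.
\<close>

fun moved_pair :: "nat \<Rightarrow> nat \<times> nat \<Rightarrow> nat \<times> nat" where
  "moved_pair k (j, i) =
     (if k + 1 = j then (j - 1, i)
      else if k = j then (j + 1, i)
      else if shifted_letter k (j, i) = i + 1 then (j, i + 1)
      else if shifted_letter k (j, i) = i then (j, i - 1)
      else (j, i))"

fun passed_letter :: "nat \<Rightarrow> nat \<times> nat \<Rightarrow> nat" where
  "passed_letter k (j, i) =
     (let k' = shifted_letter k (j, i) in if k' < i then k' + 1 else k')"

abbreviation pair_word :: "nat \<Rightarrow> nat \<times> nat \<Rightarrow> nat list" where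
  "pair_word n b \<equiv> B_word n (fst b) (snd b)"

lemma set_B_word:
  assumes "1 \<le> j" "i \<le> n"
  shows "set (B_word n j i) \<subseteq> {1..n + 1}"
  using assms by (auto simp: B_word_def h_word_def)

lemma letter_up_word:
  assumes "1 \<le> k" "k \<le> n" "1 \<le> j" "j \<le> n + 1" "k \<noteq> j" "k + 1 \<noteq> j"
  shows "[k] @ up_word j n \<approx>\<^bsub>n\<^esub> up_word j n @ [if k < j then k else k - 1]"
  using far_up_word[of k j n] up_word_shift[of j k n] assms by auto

lemma letter_down_word:
  assumes "1 \<le> k" "k \<le> n" "i < n" "k \<noteq> i" "k \<noteq> i + 1"
  shows "[k] @ down_word i 1 \<approx>\<^bsub>n\<^esub> down_word i 1 @ [if k < i then k + 1 else k]"
  using far_down_word[of i k n] down_word_shift[of k i n] assms by auto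

lemma letter_up_word_absorb:
  assumes "1 \<le> k" "k \<le> n"
  shows "[k] @ up_word k n \<approx>\<^bsub>n\<^esub> up_word (k + 1) n"
  using affA.cong_right[OF affA.square_eq_Nil[of k n], of "up_word (k + 1) n"] assms
  by (simp add: up_word_Cons[of k])

lemma letter_down_word_absorb:
  assumes "1 \<le> k" "k \<le> n"
  shows "[k] @ down_word k 1 \<approx>\<^bsub>n\<^esub> down_word (k - 1) 1"
proof -
  have "[k, k] @ down_word (k - 1) 1 \<approx>\<^bsub>n\<^esub> [] @ down_word (k - 1) 1"
    using assms by (intro affA.cong_right affA.square_eq_Nil) auto
  then show ?thesis using assms down_word_Cons[of 1 "k - 1"] by simp
qed

lemma letter_moves_pair:
  assumes n: "2 \<le> n" and k: "1 \<le> k" "k \<le> n" and b: "entry_ok n b"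
    and move: "moved_pair k b \<noteq> b"
  shows "entry_ok n (moved_pair k b) \<and> [k] @ pair_word n b \<approx>\<^bsub>n\<^esub> pair_word n (moved_pair k b)"
proof -
  obtain j i where ji: "b = (j, i)" by fastforce
  have b': "1 \<le> j" "j \<le> n + 1" "i < n" using b n unfolding ji entry_ok_def by auto
  define k' where "k' = (if k < j then k else k - 1)"
  consider "k + 1 = j" | "k = j"
    | "k + 1 \<noteq> j" "k \<noteq> j" "k' = i + 1"
    | "k + 1 \<noteq> j" "k \<noteq> j" "k' = i" "k' \<noteq> i + 1"
    using move unfolding ji k'_def by (auto split: if_splits)
  then show ?thesis
  proof cases
    case 1
    then have "[k] @ pair_word n b = pair_word n (moved_pair k b)"
      using up_word_Cons[of k n] k unfolding ji by (auto simp: B_word_def h_word_def)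
    moreover have "set (pair_word n (moved_pair k b)) \<subseteq> {1..n + 1}"
      using 1 b' k set_B_word[of k i n] unfolding ji by auto
    ultimately show ?thesis
      using 1 b' k affA.weq_refl unfolding ji by (auto simp: entry_ok_def)
  next
    case 2
    have "([k] @ up_word j n) @ down_word i 1 @ [n + 1] \<approx>\<^bsub>n\<^esub> up_word (j + 1) n @ down_word i 1 @ [n + 1]"
      using 2 k b' by (intro affA.cong_right) (use letter_up_word_absorb in auto)
    then show ?thesis
      using 2 b' k unfolding ji by (simp add: entry_ok_def B_word_def h_word_def)
  next
    case 3
    have "([k] @ up_word j n) @ down_word i 1 @ [n + 1] \<approx>\<^bsub>n\<^esub> (up_word j n @ [k']) @ down_word i 1 @ [n + 1]"
      using 3 k b' unfolding k'_def by (intro affA.cong_right letter_up_word) auto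
    moreover have "down_word (i + 1) 1 = k' # down_word i 1"
      using 3 by (simp add: down_word_Cons)
    moreover have "i + 1 < n" using 3(3) k b' 3(1,2) unfolding k'_def by (auto split: if_splits)
    moreover have "moved_pair k b = (j, i + 1)" using 3 unfolding ji k'_def by simp
    ultimately show ?thesis
      using b' unfolding ji by (simp add: entry_ok_def B_word_def h_word_def)
  next
    case 4
    have k': "1 \<le> k'" "k' \<le> n" using 4 k b' unfolding k'_def by auto
    have "([k] @ up_word j n) @ down_word i 1 @ [n + 1] \<approx>\<^bsub>n\<^esub> (up_word j n @ [k']) @ down_word i 1 @ [n + 1]"
      using 4 k b' unfolding k'_def by (intro affA.cong_right letter_up_word) auto
    also have "\<dots> = up_word j n @ ([k'] @ down_word i 1) @ [n + 1]" by simp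
    also have "\<dots> \<approx>\<^bsub>n\<^esub> up_word j n @ down_word (i - 1) 1 @ [n + 1]"
      using 4 k' b' letter_down_word_absorb[of k' n] by (intro affA.cong_mid) auto
    finally have "[k] @ pair_word n b \<approx>\<^bsub>n\<^esub> pair_word n (j, i - 1)"
      unfolding ji by (simp add: B_word_def h_word_def)
    moreover have "moved_pair k b = (j, i - 1)" using 4 unfolding ji k'_def by simp
    ultimately show ?thesis
      using b' by (simp add: entry_ok_def)
  qed
qed

text \<open>
  The letter that leaves \<open>h(j,i)\<close> transposes two neighbouring points among \<open>2, \<dots>, n\<close>. It is therefore
  different from \<open>\<sigma>\<^sub>1\<close> and \<open>\<sigma>\<^sub>n\<close> and commutes with the affine generator.
\<close>

lemma letter_passes_pair:
  assumes n: "2 \<le> n" and k: "1 \<le> k" "k \<le> n" and b: "entry_ok n b"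
    and fixed: "moved_pair k b = b"
  shows "2 \<le> passed_letter k b \<and> passed_letter k b < n
    \<and> [k] @ pair_word n b \<approx>\<^bsub>n\<^esub> pair_word n b @ [passed_letter k b]"
proof -
  obtain j i where ji: "b = (j, i)" by fastforce
  have b': "1 \<le> j" "j \<le> n + 1" "i < n" using b n unfolding ji entry_ok_def by auto
  define k' where "k' = (if k < j then k else k - 1)"
  define v where "v = (if k' < i then k' + 1 else k')"
  have v_eq: "passed_letter k b = v" unfolding ji v_def k'_def by (simp add: Let_def)
  have c: "k + 1 \<noteq> j" "k \<noteq> j" "k' \<noteq> i + 1"
    using fixed b' unfolding ji k'_def by (auto split: if_splits)
  have k': "1 \<le> k'" "k' < n" using k b' c unfolding k'_def by auto
  then have c': "k' \<noteq> i"
    using fixed c unfolding ji k'_def by (auto split: if_splits)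
  have v: "2 \<le> v" "v < n" using k' b' c c' unfolding v_def by auto
  have "([k] @ up_word j n) @ down_word i 1 @ [n + 1] \<approx>\<^bsub>n\<^esub> (up_word j n @ [k']) @ down_word i 1 @ [n + 1]"
    using c k b' unfolding k'_def by (intro affA.cong_right letter_up_word) auto
  also have "\<dots> = up_word j n @ ([k'] @ down_word i 1) @ [n + 1]" by simp
  also have "\<dots> \<approx>\<^bsub>n\<^esub> up_word j n @ (down_word i 1 @ [v]) @ [n + 1]"
    unfolding v_def using c c' k' b' by (intro affA.cong_mid letter_down_word) auto
  also have "\<dots> = (up_word j n @ down_word i 1) @ [v, n + 1]" by simp
  also have "\<dots> \<approx>\<^bsub>n\<^esub> (up_word j n @ down_word i 1) @ [n + 1, v]"
    using v b' by (intro affA.cong_left affA.commute) (auto simp: affA_matrix_eq)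
  finally show ?thesis using v v_eq unfolding ji by (simp add: B_word_def h_word_def)
qed

text \<open>
  The word \<open>\<lceil>l,1\<rceil> a\<close> is a path because \<open>l < n\<close>. So \<open>\<lceil>l,1\<rceil>\<close> passes through it from the right and comes out as
  \<open>\<lceil>l-1,1\<rceil> a\<close>; the surplus \<open>a\<close> then crosses the path \<open>\<lfloor>x,n\<rfloor> a\<close> and becomes \<open>\<sigma>\<^sub>n\<close>.
\<close>

lemma double_down_affine:
  assumes "1 \<le> l" "l < n" "2 \<le> x" "x \<le> n"
  shows "down_word l 1 @ [n + 1] @ down_word l 1 @ up_word x n @ [n + 1]
    \<approx>\<^bsub>n\<^esub> down_word (l - 1) 1 @ [n + 1] @ down_word l 1 @ up_word x n @ [n + 1, n]"
proof -
  let ?D = "down_word l 1 @ [n + 1]" and ?U = "up_word x n @ [n + 1]"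
  have tl: "tl ?D = down_word (l - 1) 1 @ [n + 1]"
    using assms down_word_Cons[of 1 "l - 1"] by simp
  have "tl ?D @ ?D \<approx>\<^bsub>n\<^esub> ?D @ butlast ?D"
    using assms by (intro affA.path_shift_tl path_down_word_affine)
  then have "(?D @ down_word l 1) @ ?U \<approx>\<^bsub>n\<^esub> (tl ?D @ ?D) @ ?U"
    using assms by (intro affA.cong_right) (auto intro: cox_sym)
  also have "\<dots> = (tl ?D @ down_word l 1) @ ([n + 1] @ ?U)" by simp
  also have "\<dots> \<approx>\<^bsub>n\<^esub> (tl ?D @ down_word l 1) @ (?U @ [n])"
  proof (rule affA.cong_left)
    show "[n + 1] @ ?U \<approx>\<^bsub>n\<^esub> ?U @ [n]"
      using affA.path_shift[OF path_up_word_affine[of x n], of "n - x"] assms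
      by (simp add: nth_append nth_up_word Suc_diff_le)
    show "set (tl ?D @ down_word l 1) \<subseteq> {1..n + 1}" using assms unfolding tl by auto
  qed
  finally show ?thesis unfolding tl by simp
qed

text \<open>
  The mirror image of the previous identity under the symmetry of the diagram that fixes \<open>a\<close>.
\<close>

lemma double_up_affine:
  assumes "2 \<le> l" "l \<le> n" "1 \<le> i" "i < n"
  shows "up_word l n @ [n + 1] @ up_word l n @ down_word i 1 @ [n + 1]
    \<approx>\<^bsub>n\<^esub> up_word (l + 1) n @ [n + 1] @ up_word l n @ down_word i 1 @ [n + 1, 1]"
proof -
  let ?U = "up_word l n @ [n + 1]" and ?D = "down_word i 1 @ [n + 1]"
  have tl: "tl ?U = up_word (l + 1) n @ [n + 1]"
    using assms by (simp add: up_word_Cons[of l])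
  have "tl ?U @ ?U \<approx>\<^bsub>n\<^esub> ?U @ butlast ?U"
    using assms by (intro affA.path_shift_tl path_up_word_affine) auto
  then have "(?U @ up_word l n) @ ?D \<approx>\<^bsub>n\<^esub> (tl ?U @ ?U) @ ?D"
    using assms by (intro affA.cong_right) (auto intro: cox_sym)
  also have "\<dots> = (tl ?U @ up_word l n) @ ([n + 1] @ ?D)" by simp
  also have "\<dots> \<approx>\<^bsub>n\<^esub> (tl ?U @ up_word l n) @ (?D @ [1])"
  proof (rule affA.cong_left)
    show "[n + 1] @ ?D \<approx>\<^bsub>n\<^esub> ?D @ [1]"
      using affA.path_shift[OF path_down_word_affine[of i n], of "i - 1"] assms
      by (simp add: nth_append nth_down_word)
    show "set (tl ?U @ up_word l n) \<subseteq> {1..n + 1}" using assms unfolding tl by auto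
  qed
  finally show ?thesis unfolding tl by simp
qed

text \<open>
  The case in which increasing \<open>i\<close> would violate the condition between the two pairs. Then the second pair
  has the least possible \<open>p'\<close>, which \<open>h(j,i)\<close> sends to \<open>k + 1\<close>. So \<open>\<sigma>\<^sub>k\<close> turns into the
  transposition of \<open>1\<close> and \<open>p'\<close> behind \<open>h(j,i)\<close>, and into \<open>\<sigma>\<^sub>n\<close> behind both pairs.
\<close>

lemma letter_passes_two_pairs_up:
  assumes n: "2 \<le> n" and k: "1 \<le> k" "k \<le> n" and b: "entry_ok n (j, i)"
    and ok: "next_ok n (j, i) (j', i')"
    and move: "moved_pair k (j, i) = (j, i + 1)"
    and bad: "\<not> next_ok n (j, i + 1) (j', i')"
  shows "[k] @ B_word n j i @ B_word n j' i' \<approx>\<^bsub>n\<^esub> B_word n j i @ B_word n j' i' @ [n]"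
proof -
  define l where "l = i + 1"
  \<comment> \<open>Chosen so that \<open>h(j',i')\<close> is \<open>\<lceil>l,1\<rceil> \<lfloor>x,n\<rfloor>\<close>.\<close>
  define x where "x = (if i' + 1 < j' then j' else j' + 1)"
  have m: "entry_ok n (j, i + 1)" "[k] @ B_word n j i \<approx>\<^bsub>n\<^esub> B_word n j (i + 1)"
    using letter_moves_pair[OF n k b] move by auto
  have l: "1 \<le> l" "l < n" "1 \<le> j" "j \<le> n + 1"
    using m(1) n unfolding entry_ok_def l_def by auto
  \<comment> \<open>The second pair has the least possible first image.\<close>
  have cases: "i' + 1 < j' \<and> i' = l \<or> j' \<le> i' + 1 \<and> i' + 1 = l"
    using ok bad l unfolding next_ok_def l_def by auto
  have x: "2 \<le> x" "x \<le> n" using cases ok l n unfolding next_ok_def x_def by auto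
  have h: "h_word n j' i' \<approx>\<^bsub>n\<^esub> down_word l 1 @ up_word x n"
    using cases h_word_swap_disjoint[of j' i' n] h_word_swap_meet[of j' i' n] ok l x
    unfolding x_def next_ok_def by (auto split: if_splits)
  have i': "1 \<le> j'" "i' \<le> n" using ok unfolding next_ok_def by auto
  have S: "set (up_word j n) \<subseteq> {1..n + 1}" "set (B_word n j' i') \<subseteq> {1..n + 1}"
    "set (B_word n j i) \<subseteq> {1..n + 1}"
    using set_B_word[of j' i' n] set_B_word[of j i n] b i' l unfolding l_def by auto
  have "([k] @ B_word n j i) @ B_word n j' i' \<approx>\<^bsub>n\<^esub> B_word n j (i + 1) @ B_word n j' i'"
    using m(2) S by (intro affA.cong_right)
  also have "\<dots> = (up_word j n @ down_word l 1 @ [n + 1]) @ h_word n j' i' @ [n + 1]"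
    by (simp add: B_word_def h_word_def l_def)
  also have "\<dots> \<approx>\<^bsub>n\<^esub> (up_word j n @ down_word l 1 @ [n + 1]) @ (down_word l 1 @ up_word x n) @ [n + 1]"
    using S l h by (intro affA.cong_mid) auto
  also have "\<dots> = up_word j n @ (down_word l 1 @ [n + 1] @ down_word l 1 @ up_word x n @ [n + 1])"
    by simp
  also have "\<dots> \<approx>\<^bsub>n\<^esub>
      up_word j n @ (down_word (l - 1) 1 @ [n + 1] @ down_word l 1 @ up_word x n @ [n + 1, n])"
    using S l x by (intro affA.cong_left double_down_affine) auto
  also have "\<dots> = B_word n j i @ (down_word l 1 @ up_word x n) @ [n + 1, n]"
    by (simp add: B_word_def h_word_def l_def)
  also have "\<dots> \<approx>\<^bsub>n\<^esub> B_word n j i @ h_word n j' i' @ [n + 1, n]"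
    using S l cox_sym[OF h] by (intro affA.cong_mid) auto
  finally show ?thesis by (simp add: B_word_def)
qed

text \<open>
  The mirror case: decreasing \<open>j\<close> is forbidden, and the letter leaves as \<open>\<sigma>\<^sub>1\<close>. The left factor \<open>\<lceil>z,1\<rceil>\<close> of
  both forms of \<open>h\<close> is common and is set aside.
\<close>

lemma letter_passes_two_pairs_down:
  assumes n: "2 \<le> n" and k: "1 \<le> k" "k \<le> n" and b: "entry_ok n (j, i)"
    and ok: "next_ok n (j, i) (j', i')"
    and j: "j = k + 1"
    and bad: "\<not> next_ok n (j - 1, i) (j', i')"
  shows "[k] @ B_word n j i @ B_word n j' i' \<approx>\<^bsub>n\<^esub> B_word n j i @ B_word n j' i' @ [1]"
proof -
  \<comment> \<open>Chosen so that \<open>h(j,i)\<close> is \<open>\<lceil>z,1\<rceil> \<lfloor>j'+1,n\<rfloor>\<close>.\<close>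
  define z where "z = (if j \<le> i + 1 then i + 1 else i)"
  have m: "[k] @ B_word n j i \<approx>\<^bsub>n\<^esub> B_word n (j - 1) i"
    using letter_moves_pair[OF n k b] j by auto
  \<comment> \<open>The second pair has the greatest possible entry \<open>j'\<close>.\<close>
  have cases: "j \<le> i + 1 \<and> j' = j \<or> i + 1 < j - 1 \<and> j' = j - 1"
    using ok bad j k unfolding next_ok_def by auto
  have l: "2 \<le> j'" "j' \<le> n" "1 \<le> i'" "i' < n" "i < n"
    using cases ok b j k n unfolding next_ok_def entry_ok_def by auto
  have z: "z \<le> n" using l unfolding z_def by auto
  have h: "h_word n (j - 1) i \<approx>\<^bsub>n\<^esub> down_word z 1 @ up_word j' n"
     "h_word n j i \<approx>\<^bsub>n\<^esub> down_word z 1 @ up_word (j' + 1) n"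
    using cases h_word_swap_disjoint[of j i n] h_word_swap_meet[of j i n]
      h_word_swap_disjoint[of "j - 1" i n] h_word_swap_meet[of "j - 1" i n] l j k
    unfolding z_def by auto
  have S: "set (down_word z 1) \<subseteq> {1..n + 1}" "set (B_word n j' i') \<subseteq> {1..n + 1}"
    "set (B_word n j i) \<subseteq> {1..n + 1}"
    using set_B_word[of j' i' n] set_B_word[of j i n] l j k z by auto
  have "([k] @ B_word n j i) @ B_word n j' i' \<approx>\<^bsub>n\<^esub> B_word n (j - 1) i @ B_word n j' i'"
    using m S by (intro affA.cong_right)
  also have "\<dots> = h_word n (j - 1) i @ [n + 1] @ B_word n j' i'"
    by (simp add: B_word_def)
  also have "\<dots> \<approx>\<^bsub>n\<^esub> (down_word z 1 @ up_word j' n) @ [n + 1] @ B_word n j' i'"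
    using S h by (intro affA.cong_right) auto
  also have "\<dots> = down_word z 1 @ (up_word j' n @ [n + 1] @ up_word j' n @ down_word i' 1 @ [n + 1])"
    by (simp add: B_word_def h_word_def)
  also have "\<dots> \<approx>\<^bsub>n\<^esub>
      down_word z 1 @ (up_word (j' + 1) n @ [n + 1] @ up_word j' n @ down_word i' 1 @ [n + 1, 1])"
    using S l by (intro affA.cong_left double_up_affine) auto
  also have "\<dots> = (down_word z 1 @ up_word (j' + 1) n) @ ([n + 1] @ B_word n j' i' @ [1])"
    by (simp add: B_word_def h_word_def)
  also have "\<dots> \<approx>\<^bsub>n\<^esub> h_word n j i @ ([n + 1] @ B_word n j' i' @ [1])"
    using S cox_sym[OF h(2)] by (intro affA.cong_right) auto
  finally show ?thesis by (simp add: B_word_def)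
qed

section \<open>Stability of the chain conditions\<close>

lemma next_ok_iff:
  assumes "2 \<le> n"
  shows "next_ok n (j, i) (j', i') \<longleftrightarrow>
    1 \<le> j' \<and> j' \<le> n \<and> i' < n \<and> (i' = 0 \<longrightarrow> j' = 1) \<and> j' \<le> j \<and> i \<le> i' \<and>
    (i + 1 < j \<longrightarrow> j' < j) \<and> (i' + 1 < j' \<longrightarrow> i < i')"
  using assms unfolding next_ok_def by auto

lemma moved_pair_cases:
  assumes "1 \<le> v" "1 \<le> j" "moved_pair v (j, i) = (j', i')"
  shows "j = v + 1 \<and> j' = v \<and> i' = i \<or> j = v \<and> j' = v + 1 \<and> i' = i
    \<or> v \<noteq> j \<and> v + 1 \<noteq> j \<and> j' = j \<and> i' = i + 1 \<and> (v < j \<and> v = i + 1 \<or> j < v \<and> v = i + 2)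
    \<or> v \<noteq> j \<and> v + 1 \<noteq> j \<and> j' = j \<and> i = i' + 1 \<and> (v < j \<and> v = i \<or> j < v \<and> v = i + 1)
    \<or> v \<noteq> j \<and> v + 1 \<noteq> j \<and> j' = j \<and> i' = i \<and> (v < j \<and> v \<noteq> i \<and> v \<noteq> i + 1 \<or> j < v \<and> v \<noteq> i + 1 \<and> v \<noteq> i + 2)"
  using assms by (auto split: if_splits)

lemma moved_pair_unit_step:
  assumes "1 \<le> v" "1 \<le> j"
  shows "moved_pair v (j, i) \<in> {(j + 1, i), (j, i + 1), (j, i)}
    \<or> j = v + 1 \<and> moved_pair v (j, i) = (v, i)
    \<or> (\<exists>i'. i = i' + 1 \<and> j \<noteq> i + 1 \<and> moved_pair v (j, i) = (j, i'))"
  using assms by (cases i) auto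

text \<open>
  A letter that has crossed a pair \<open>b\<close> cannot bring the next pair into conflict with \<open>b\<close>: the extremal values
  that \<open>b\<close> allows for \<open>p'\<close> and \<open>q'\<close> could only be crossed by a transposition that would have
  moved \<open>b\<close> itself.
\<close>

lemma next_ok_after_pass:
  assumes n: "2 \<le> n" and k: "1 \<le> k" "k \<le> n" and b: "entry_ok n b"
    and "moved_pair k b = b" and ok: "next_ok n b b'"
  shows "next_ok n b (moved_pair (passed_letter k b) b')"
proof -
  obtain j i j' i' where e: "b = (j, i)" "b' = (j', i')" by fastforce
  define v where "v = passed_letter k b"
  obtain j'' i'' where m: "moved_pair v (j', i') = (j'', i'')" by fastforce
  have b': "1 \<le> j" "j \<le> n + 1" "i < n" using b n unfolding e entry_ok_def by auto
  note c = moved_pair_cases[OF k(1) b'(1) assms(5)[unfolded e]]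
  have v: "k + 1 < j \<and> (k < i \<and> v = k + 1 \<or> i + 1 < k \<and> v = k)
    \<or> j < k \<and> (k < i + 1 \<and> v = k \<or> i + 2 < k \<and> k = v + 1)"
    using c unfolding v_def e by (auto simp: Let_def)
  have "1 \<le> v" using v by linarith
  have "1 \<le> j'" using ok unfolding e next_ok_def by auto
  have v1: "2 \<le> v" "v < n" using v k b' by linarith+
  have v2: "v \<noteq> i + 1" "j = v + 1 \<longrightarrow> j \<le> i + 1" "j = v \<longrightarrow> i + 1 < j"
    using v by linarith+
  have o: "1 \<le> j'" "j' \<le> n" "i' < n" "i' = 0 \<longrightarrow> j' = 1" "j' \<le> j" "i \<le> i'"
    "i + 1 < j \<longrightarrow> j' < j" "i' + 1 < j' \<longrightarrow> i < i'"
    using ok unfolding e next_ok_iff[OF n] by blast+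
  consider "j' = v + 1" "j'' = v" "i'' = i'" | "j' = v" "j'' = v + 1" "i'' = i'"
    | "j'' = j'" "i'' = i' + 1" "v = i' + 1 \<or> v = i' + 2"
    | "j'' = j'" "i' = i'' + 1" "v < j'" "v + 1 \<noteq> j'" "v = i'"
    | "j'' = j'" "i' = i'' + 1" "j' < v" "v = i' + 1"
    | "j'' = j'" "i'' = i'"
    using moved_pair_cases[OF \<open>1 \<le> v\<close> \<open>1 \<le> j'\<close> m] by blast
  then have "next_ok n (j, i) (j'', i'')"
  proof cases
    case 1
    have "i' \<noteq> 0" using o(4) 1(1) v1 by auto
    then show ?thesis
      using 1 o v1 unfolding next_ok_iff[OF n] by simp
  next
    case 2
    have "i' \<noteq> 0" using o(4) 2(1) v1 by auto
    moreover have "v + 1 \<le> j" "i + 1 < j \<longrightarrow> v + 1 < j"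
      using o(5,7) v2(2,3) 2(1) by linarith+
    moreover have "i < i'" if "i' < v"
      using that o(6,8) v2(1) 2(1) by linarith
    ultimately show ?thesis
      using 2(2,3) o(3,6) v1 unfolding next_ok_iff[OF n] by simp
  next
    case 3
    then have "i'' < n" using v1 by linarith
    then show ?thesis
      using 3(1,2) o unfolding next_ok_iff[OF n] by simp
  next
    case 4
    have "i < i'" using o(8) 4(3,4,5) by linarith
    then have "i < i''" using 4(2,5) v2(1) by linarith
    moreover have "i'' < n" "i'' \<noteq> 0" using 4(2,5) v1 by linarith+
    ultimately show ?thesis
      using 4(1) o unfolding next_ok_iff[OF n] by simp
  next
    case 5
    have "i \<le> i''" "i'' < n" "i'' = 0 \<longrightarrow> j' = 1" "\<not> i'' + 1 < j'"
      using 5(2,3,4) v1 v2(1) o(1,6) by linarith+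
    then show ?thesis
      using 5(1) o unfolding next_ok_iff[OF n] by simp
  next
    case 6
    then show ?thesis using ok unfolding e by simp
  qed
  then show ?thesis unfolding e v_def[symmetric, unfolded e] m .
qed

text \<open>
  The letter \<open>\<sigma>\<^sub>n\<close> can only raise \<open>i'\<close> to its maximum or lower it from there, or interchange the values
  \<open>n\<close> and \<open>n + 1\<close> of \<open>j'\<close>; the last is excluded by \<open>j' < n\<close>.
\<close>

lemma next_ok_moved_last:
  assumes n: "2 \<le> n" and ok: "next_ok n (j, i) (j', i')" and "i + 1 < n" "j' < n"
  shows "next_ok n (j, i) (moved_pair n (j', i'))"
proof -
  obtain x y where m: "moved_pair n (j', i') = (x, y)" by fastforce
  have o: "1 \<le> j'" "i' < n" using ok unfolding next_ok_iff[OF n] by blast+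
  consider "x = j'" "y = i' + 1" "i' + 2 = n" | "x = j'" "i' = y + 1" "i' + 1 = n" | "x = j'" "y = i'"
    using m o(2) n \<open>j' < n\<close> by (cases i') (auto split: if_splits)
  then show ?thesis
  proof cases
    case 1
    then show ?thesis
      using ok unfolding m next_ok_iff[OF n] by simp
  next
    case 2
    then have "y = 0 \<longrightarrow> x = 1" "\<not> y + 1 < x" "i \<le> y"
      using \<open>j' < n\<close> \<open>i + 1 < n\<close> o(1) by linarith+
    then show ?thesis
      using ok 2 unfolding m next_ok_iff[OF n] by simp
  next
    case 3
    then show ?thesis using ok unfolding m by simp
  qed
qed

lemma next_ok_moved_first:
  assumes n: "2 \<le> n" and ok: "next_ok n (j, i) (j', i')" and "2 \<le> j" "1 \<le> i"
  shows "next_ok n (j, i) (moved_pair 1 (j', i'))"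
proof -
  obtain x y where m: "moved_pair 1 (j', i') = (x, y)" by fastforce
  have o: "1 \<le> j'" "j' \<le> n" "i' < n" "j' \<le> j" "i \<le> i'" "i + 1 < j \<longrightarrow> j' < j"
    "i' + 1 < j' \<longrightarrow> i < i'"
    using ok unfolding next_ok_iff[OF n] by blast+
  have "1 \<le> i'" using \<open>1 \<le> i\<close> o(5) by linarith
  then consider "x = 1" "y = i'" | "x = 2" "y = i'" | "i' = 1" "3 \<le> j'" | "x = j'" "y = i'"
    using m \<open>1 \<le> j'\<close> by (auto split: if_splits)
  then show ?thesis
  proof cases
    case 1
    then show ?thesis
      using n assms(3,4) o \<open>1 \<le> i'\<close> unfolding m next_ok_iff[OF n] by simp
  next
    case 2
    then show ?thesis
      using n assms(3,4) o(3,5) \<open>1 \<le> i'\<close> unfolding m next_ok_iff[OF n] by simp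
  next
    case 3
    then show ?thesis using o(7) \<open>1 \<le> i\<close> by simp
  next
    case 4
    then show ?thesis using ok unfolding m by simp
  qed
qed

text \<open>
  After a double crossing the letter \<open>\<sigma>\<^sub>n\<close> reaches a third pair. Since the first two pairs touch, the second
  one has \<open>i' + 1 < n\<close> and the third one has \<open>j'' < n\<close>, as \<open>next_ok_moved_last\<close> demands.
\<close>

lemma next_ok_after_double_up:
  assumes n: "2 \<le> n" and b: "entry_ok n (j, i)" "i + 1 < n"
    and ok: "next_ok n (j, i) b'" and bad: "\<not> next_ok n (j, i + 1) b'" and ok': "next_ok n b' b''"
  shows "next_ok n b' (moved_pair n b'')"
proof -
  obtain j' i' j'' i'' where e: "b' = (j', i')" "b'' = (j'', i'')" by fastforce
  have b': "j \<le> n + 1" using b unfolding entry_ok_def by simp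
  have o: "j' \<le> n" "i' < n" "j' \<le> j" "i \<le> i'" "i + 1 < j \<longrightarrow> j' < j" "i' + 1 < j' \<longrightarrow> i < i'"
    using ok unfolding e next_ok_iff[OF n] by blast+
  have o'': "j'' \<le> j'" "i' + 1 < j' \<longrightarrow> j'' < j'"
    using ok' unfolding e next_ok_iff[OF n] by blast+
  \<comment> \<open>Rejecting the increased entry means that the two pairs already touch.\<close>
  have tight: "i' = i + 1 \<and> i' + 1 < j' \<or> i' = i \<and> j' \<le> i' + 1"
  proof (rule ccontr)
    assume "\<not> ?thesis"
    then have "i + 1 \<le> i'" "i' + 1 < j' \<longrightarrow> i + 1 < i'" "i + 1 + 1 < j \<longrightarrow> j' < j"
      using o by linarith+
    then have "next_ok n (j, i + 1) (j', i')"
      using ok unfolding e next_ok_iff[OF n] by blast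
    then show False using bad unfolding e by blast
  qed
  have i': "i' + 1 < n" using tight b(2) o(1) by linarith
  have "j'' < n"
  proof (cases "j' = n")
    case True
    then show ?thesis using o''(2) i' by linarith
  next
    case False
    then show ?thesis using o''(1) o(1) by linarith
  qed
  then show ?thesis
    using next_ok_moved_last[OF n] ok' i' unfolding e by blast
qed

lemma next_ok_after_double_down:
  assumes n: "2 \<le> n" and b: "entry_ok n (j, i)" "2 \<le> j"
    and ok: "next_ok n (j, i) b'" and bad: "\<not> next_ok n (j - 1, i) b'" and ok': "next_ok n b' b''"
  shows "next_ok n b' (moved_pair 1 b'')"
proof -
  obtain j' i' j'' i'' where e: "b' = (j', i')" "b'' = (j'', i'')" by fastforce
  obtain j0 where j0: "j = j0 + 1" using b(2) by (metis Suc_eq_plus1 Suc_le_D numeral_2_eq_2)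
  have o: "1 \<le> j'" "i' = 0 \<longrightarrow> j' = 1"
    using ok unfolding e next_ok_iff[OF n] by blast+
  have "j' \<noteq> 1"
  proof
    assume "j' = 1"
    then have "next_ok n (j - 1, i) (j', i')"
      using ok b(2) unfolding e next_ok_iff[OF n] j0 by simp
    then show False using bad unfolding e by blast
  qed
  then have "2 \<le> j'" using o by linarith
  moreover have "1 \<le> i'" using o(2) \<open>j' \<noteq> 1\<close> by (cases i') auto
  ultimately have d: "2 \<le> j'" "1 \<le> i'" by blast+
  show ?thesis
    using next_ok_moved_first[OF n _ d] ok' unfolding e by blast
qed

text \<open>
  Only the changes that push \<open>p\<close> up or \<open>q\<close> down can conflict with the following pair, whose own
  \<open>p'\<close> has to stay above \<open>p\<close> and \<open>q'\<close> below \<open>q\<close>.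
\<close>

lemma next_ok_moved:
  assumes n: "2 \<le> n" and k: "1 \<le> k" "k \<le> n" and b: "entry_ok n (j, i)"
    and ok: "next_ok n (j, i) b'"
    and move: "moved_pair k (j, i) \<noteq> (j, i)" and bad: "\<not> next_ok n (moved_pair k (j, i)) b'"
  shows "moved_pair k (j, i) = (j, i + 1) \<or> j = k + 1 \<and> moved_pair k (j, i) = (j - 1, i)"
proof -
  obtain j' i' where e: "b' = (j', i')" by fastforce
  obtain x y where m: "moved_pair k (j, i) = (x, y)" by fastforce
  have "1 \<le> j" using b unfolding entry_ok_def by auto
  then consider "j = k + 1" "x = k" "y = i" | "x = j" "y = i + 1"
    | "x = j + 1" "y = i" | "x = j" "i = y + 1" "j \<noteq> i + 1" | "x = j" "y = i"
    using moved_pair_unit_step[OF k(1), of j i] unfolding m by blast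
  then show ?thesis
  proof cases
    case 3
    then have "next_ok n (x, y) (j', i')"
      using ok unfolding e next_ok_iff[OF n] by simp
    then show ?thesis using bad unfolding e m by blast
  next
    case 4
    have o: "1 \<le> j'" "j' \<le> n" "i' < n" "i' = 0 \<longrightarrow> j' = 1" "j' \<le> j" "i \<le> i'" "i + 1 < j \<longrightarrow> j' < j"
      using ok unfolding e next_ok_iff[OF n] by blast+
    have "y + 1 < j \<longrightarrow> j' < j" "y < i'" using o(6,7) 4(2,3) by linarith+
    then have "next_ok n (x, y) (j', i')"
      using o 4(1) unfolding next_ok_iff[OF n] by simp
    then show ?thesis using bad unfolding e m by blast
  next
    case 1
    then show ?thesis unfolding m by simp
  next
    case 2
    then show ?thesis unfolding m by simp
  next
    case 5
    then show ?thesis using move unfolding m by simp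
  qed
qed

section \<open>A generator in front of a whole block\<close>

text \<open>
  The empty list is admitted, so that the tail of a block is again of this kind and the
  induction over blocks can start.
\<close>

definition valid_block :: "nat \<Rightarrow> (nat \<times> nat) list \<Rightarrow> bool" where
  "valid_block n bs \<longleftrightarrow> (bs \<noteq> [] \<longrightarrow> entry_ok n (hd bs)) \<and> successively (next_ok n) bs"

definition unit_change :: "nat \<times> nat \<Rightarrow> nat \<times> nat \<Rightarrow> bool" where
  "unit_change b b' \<longleftrightarrow>
     snd b' = snd b \<and> (fst b' + 1 = fst b \<or> fst b' = fst b + 1) \<or>
     fst b' = fst b \<and> (snd b' + 1 = snd b \<or> snd b' = snd b + 1)"

text \<open>
  What a letter does to a block: it either leaves on the right as a generator of \<open>W(A\<^sub>n)\<close>, or it changes one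
  entry of one pair by one. If this is the first pair, the new pair is recorded, because the
  condition linking it to a preceding pair has to be checked.
\<close>

definition letter_outcome :: "nat \<Rightarrow> nat \<Rightarrow> (nat \<times> nat) list \<Rightarrow> bool" where
  "letter_outcome n k bs \<longleftrightarrow>
     (\<exists>v\<in>{1..n}. [k] @ block_word n bs \<approx>\<^bsub>n\<^esub> block_word n bs @ [v]) \<or>
     (\<exists>r<length bs. \<exists>b'. unit_change (bs ! r) b' \<and> valid_block n (bs[r := b']) \<and>
        [k] @ block_word n bs \<approx>\<^bsub>n\<^esub> block_word n (bs[r := b']) \<and>
        (r = 0 \<longrightarrow> b' = moved_pair k (hd bs)))"

lemma affine_block_iff_valid_block:
  "affine_block n bs \<longleftrightarrow> bs \<noteq> [] \<and> valid_block n bs"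
proof -
  have "(\<forall>s. 1 \<le> s \<and> s < length bs \<longrightarrow> P (s - 1) s) = (\<forall>s. Suc s < length bs \<longrightarrow> P s (Suc s))" for P
    by (metis One_nat_def Suc_le_eq Suc_pred diff_Suc_1 zero_less_Suc)
  note * = this[of "\<lambda>s t. next_ok n (bs ! s) (bs ! t)"]
  show ?thesis
    unfolding affine_block_def valid_block_def successively_conv_nth *[symmetric]
    unfolding next_ok_def entry_ok_def Let_def by (cases bs) (auto 0 3)
qed

lemma entry_ok_if_next_ok: "next_ok n b b' \<Longrightarrow> 2 \<le> n \<Longrightarrow> entry_ok n b'"
  unfolding next_ok_def entry_ok_def by auto

lemma valid_block_Nil [simp]: "valid_block n []"
  by (simp add: valid_block_def)

lemma valid_block_append:
  assumes "2 \<le> n" "p \<noteq> []"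
  shows "valid_block n (p @ bs) \<longleftrightarrow>
    valid_block n p \<and> valid_block n bs \<and> (bs \<noteq> [] \<longrightarrow> next_ok n (last p) (hd bs))"
  using assms entry_ok_if_next_ok[of n "last p" "hd bs"]
  unfolding valid_block_def by (auto simp: successively_append_iff)

lemma valid_block_single: "valid_block n [b] \<longleftrightarrow> entry_ok n b"
  by (simp add: valid_block_def)

lemma valid_block_Cons:
  assumes "2 \<le> n"
  shows "valid_block n (b # bs) \<longleftrightarrow>
    entry_ok n b \<and> valid_block n bs \<and> (bs \<noteq> [] \<longrightarrow> next_ok n b (hd bs))"
  using valid_block_append[OF assms, of "[b]" bs] by (simp add: valid_block_single)

lemma block_word_append [simp]: "block_word n (p @ bs) = block_word n p @ block_word n bs"
  by (simp add: block_word_def)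

lemma block_word_Cons [simp]: "block_word n (b # bs) = pair_word n b @ block_word n bs"
  by (simp add: block_word_def split: prod.split)

lemma block_word_Nil [simp]: "block_word n [] = []"
  by (simp add: block_word_def)

lemma set_block_word:
  assumes "2 \<le> n" "valid_block n bs"
  shows "set (block_word n bs) \<subseteq> {1..n + 1}"
  using assms(2)
proof (induction bs)
  case (Cons b bs)
  then have "set (block_word n bs) \<subseteq> {1..n + 1}" "1 \<le> fst b" "snd b \<le> n"
    using assms(1) by (auto simp: valid_block_Cons entry_ok_def)
  then show ?case using set_B_word[of "fst b" "snd b" n] by simp
qed simp

lemma unit_change_moved_pair:
  assumes "1 \<le> k" "entry_ok n b" "moved_pair k b \<noteq> b"
  shows "unit_change b (moved_pair k b)"
proof -
  obtain j i where "b = (j, i)" by fastforce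
  then show ?thesis
    using moved_pair_unit_step[of k j i] assms unfolding entry_ok_def
    by (auto simp: unit_change_def simp del: moved_pair.simps)
qed

text \<open>
  The outcome for a tail is the outcome for the whole block once the letter has crossed a nonempty
  front part \<open>p\<close>, provided that the last pair of \<open>p\<close> tolerates a change of the first pair of the tail.
\<close>

lemma letter_outcome_append:
  assumes n: "2 \<le> n" and p: "p \<noteq> []"
    and pass: "[k] @ block_word n p \<approx>\<^bsub>n\<^esub> block_word n p @ [v]"
    and out: "letter_outcome n v bs"
    and valid: "valid_block n (p @ bs)"
    and glue: "bs \<noteq> [] \<Longrightarrow> next_ok n (last p) (moved_pair v (hd bs))"
  shows "letter_outcome n k (p @ bs)"
proof -
  have v: "valid_block n p" "valid_block n bs" "bs \<noteq> [] \<Longrightarrow> next_ok n (last p) (hd bs)"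
    using valid valid_block_append[OF n p] by auto
  have S: "set (block_word n p) \<subseteq> {1..n + 1}" "set (block_word n bs) \<subseteq> {1..n + 1}"
    using v n set_block_word by auto
  have "([k] @ block_word n p) @ block_word n bs \<approx>\<^bsub>n\<^esub> (block_word n p @ [v]) @ block_word n bs"
    using pass S by (intro affA.cong_right)
  then have step: "[k] @ block_word n (p @ bs) \<approx>\<^bsub>n\<^esub> block_word n p @ ([v] @ block_word n bs)"
    by simp
  have cross: "[k] @ block_word n (p @ bs) \<approx>\<^bsub>n\<^esub> block_word n p @ w"
    if "[v] @ block_word n bs \<approx>\<^bsub>n\<^esub> w" for w
    using cox_trans[OF step affA.cong_left[OF that S(1)]] .
  from out consider u where "u \<in> {1..n}" "[v] @ block_word n bs \<approx>\<^bsub>n\<^esub> block_word n bs @ [u]"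
    | r b' where "r < length bs" "unit_change (bs ! r) b'" "valid_block n (bs[r := b'])"
        "[v] @ block_word n bs \<approx>\<^bsub>n\<^esub> block_word n (bs[r := b'])"
        "r = 0 \<longrightarrow> b' = moved_pair v (hd bs)"
    unfolding letter_outcome_def by blast
  then show ?thesis
  proof cases
    case 1
    then show ?thesis using cross[OF 1(2)] unfolding letter_outcome_def by auto
  next
    case (2 r b')
    have upd: "(p @ bs)[length p + r := b'] = p @ bs[r := b']"
      by (simp add: list_update_append)
    have "bs \<noteq> []" using 2(1) by auto
    then have "next_ok n (last p) (hd (bs[r := b']))"
      using 2(1,5) glue v(3) by (cases r; cases bs) auto
    then have "valid_block n (p @ bs[r := b'])"
      using v 2(3) n p by (simp add: valid_block_append)
    moreover have "(p @ bs) ! (length p + r) = bs ! r" by (simp add: nth_append)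
    moreover have "length p + r < length (p @ bs)" "length p + r \<noteq> 0" using 2(1) p by auto
    ultimately show ?thesis
      using 2(2) cross[OF 2(4)] upd
      unfolding letter_outcome_def by (metis block_word_append)
  qed
qed

text \<open>
  The letter meets the first pair \<open>b\<close>. If it does not move \<open>b\<close>, it crosses \<open>b\<close> and meets the tail. If it moves
  \<open>b\<close> compatibly with the second pair, this is the change. Otherwise the first two pairs touch, the letter
  crosses both of them, and it meets the tail after them as \<open>\<sigma>\<^sub>1\<close> or \<open>\<sigma>\<^sub>n\<close>.
\<close>

lemma letter_outcome_generator:
  assumes n: "2 \<le> n"
  shows "1 \<le> k \<Longrightarrow> k \<le> n \<Longrightarrow> valid_block n bs \<Longrightarrow> letter_outcome n k bs"
proof (induction bs arbitrary: k rule: length_induct)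
  case (1 bs)
  note k = 1(2,3) and IH = 1(1)
  show ?case
  proof (cases bs)
    case Nil
    then show ?thesis
      using k affA.weq_refl[of "[k]" n] unfolding letter_outcome_def by auto
  next
    case (Cons b rest)
    have v: "entry_ok n b" "valid_block n rest" "rest \<noteq> [] \<Longrightarrow> next_ok n b (hd rest)"
      using 1(4) n unfolding Cons by (auto simp: valid_block_Cons)
    show ?thesis
    proof (cases "moved_pair k b = b")
      case True
      note pass = letter_passes_pair[OF n k v(1) True]
      have "letter_outcome n (passed_letter k b) rest"
        using IH Cons pass v(2) by auto
      moreover have "next_ok n b (moved_pair (passed_letter k b) (hd rest))" if "rest \<noteq> []"
        using next_ok_after_pass[OF n k v(1) True v(3)[OF that]] .
      ultimately have "letter_outcome n k ([b] @ rest)"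
        using pass 1(4) n by (intro letter_outcome_append) (auto simp: Cons)
      then show ?thesis by (simp add: Cons)
    next
      case False
      define b' where "b' = moved_pair k b"
      note move = letter_moves_pair[OF n k v(1) False, folded b'_def]
      show ?thesis
      proof (cases "rest \<noteq> [] \<longrightarrow> next_ok n b' (hd rest)")
        case True
        have "([k] @ pair_word n b) @ block_word n rest \<approx>\<^bsub>n\<^esub> pair_word n b' @ block_word n rest"
          using move set_block_word[OF n v(2)] by (intro affA.cong_right) auto
        then have "[k] @ block_word n bs \<approx>\<^bsub>n\<^esub> block_word n (bs[0 := b'])"
          by (simp add: Cons)
        moreover have "valid_block n (bs[0 := b'])"
          using True v(2) move n by (simp add: Cons valid_block_Cons)
        moreover have "unit_change (bs ! 0) b'"
          using unit_change_moved_pair[OF k(1) v(1) False] by (simp add: Cons b'_def)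
        moreover have "0 < length bs" "0 = 0 \<longrightarrow> b' = moved_pair k (hd bs)"
          by (simp_all add: Cons b'_def)
        ultimately show ?thesis unfolding letter_outcome_def by blast
      next
        case bad: False
        then obtain c rest' where rest: "rest = c # rest'" by (cases rest) auto
        obtain j i j' i' where ji: "b = (j, i)" "c = (j', i')" by fastforce
        have ok: "next_ok n b c" "\<not> next_ok n b' c" using bad v(3) by (auto simp: rest)
        have v': "entry_ok n c" "valid_block n rest'" "rest' \<noteq> [] \<Longrightarrow> next_ok n c (hd rest')"
          using v(2) n by (auto simp: rest valid_block_Cons)
        obtain u where u: "1 \<le> u" "u \<le> n"
          "[k] @ block_word n [b, c] \<approx>\<^bsub>n\<^esub> block_word n [b, c] @ [u]"
          "rest' \<noteq> [] \<Longrightarrow> next_ok n c (moved_pair u (hd rest'))"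
        proof -
          have eb: "entry_ok n (j, i)" and okp: "next_ok n (j, i) (j', i')"
            using v(1) ok(1) ji by auto
          from next_ok_moved[OF n k eb okp] False ok(2)
          consider "b' = (j, i + 1)" | "j = k + 1" "b' = (j - 1, i)"
            unfolding b'_def ji by blast
          then show ?thesis
          proof cases
            case 1
            have "i + 1 < n" using move n unfolding 1 entry_ok_def by auto
            then have "next_ok n c (moved_pair n (hd rest'))" if "rest' \<noteq> []"
              using next_ok_after_double_up[OF n eb] ok 1 v'(3) that unfolding ji by blast
            moreover have "[k] @ B_word n j i @ B_word n j' i' \<approx>\<^bsub>n\<^esub> B_word n j i @ B_word n j' i' @ [n]"
              using letter_passes_two_pairs_up[OF n k eb okp] ok(2) 1 unfolding b'_def ji by simp
            ultimately show ?thesis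
              using that[of n] n unfolding ji by simp
          next
            case 2
            have "next_ok n c (moved_pair 1 (hd rest'))" if "rest' \<noteq> []"
              using next_ok_after_double_down[OF n eb] ok 2 v'(3) that k unfolding ji by simp
            moreover have "[k] @ B_word n j i @ B_word n j' i' \<approx>\<^bsub>n\<^esub> B_word n j i @ B_word n j' i' @ [1]"
              using letter_passes_two_pairs_down[OF n k eb okp] ok(2) 2 unfolding ji by simp
            ultimately show ?thesis
              using that[of 1] n unfolding ji by simp
          qed
        qed
        have "letter_outcome n u rest'"
          using IH u v'(2) by (auto simp: Cons rest)
        then have "letter_outcome n k ([b, c] @ rest')"
          using u 1(4) n by (intro letter_outcome_append) (auto simp: Cons rest)
        then show ?thesis by (simp add: Cons rest)
      qed
    qed
  qed
qed

section \<open>An action on integer vectors and a lower bound for the length\<close>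

text \<open>
  Affine reflections of the lattice of integer vectors with coordinates in \<open>{1..n + 1}\<close>: the letter
  \<open>k \<le> n\<close> swaps two neighbours, and the affine letter swaps the first and the last coordinate with a
  shift. The letters of \<open>W(A\<^sub>n)\<close> fix the origin, so the image of the origin is an invariant of a left
  coset of that subgroup.
\<close>

definition letter_act :: "nat \<Rightarrow> nat \<Rightarrow> (nat \<Rightarrow> int) \<Rightarrow> (nat \<Rightarrow> int)" where
  "letter_act n s c =
     (if s = n + 1 then c(1 := c (n + 1) - 1, n + 1 := c 1 + 1)
      else c(s := c (s + 1), s + 1 := c s))"

abbreviation word_act :: "nat \<Rightarrow> nat list \<Rightarrow> (nat \<Rightarrow> int) \<Rightarrow> (nat \<Rightarrow> int)" where
  "word_act n \<equiv> foldr (letter_act n)"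

lemma letter_act_square:
  assumes "2 \<le> n"
  shows "letter_act n s (letter_act n s c) = c"
  using assms by (auto simp: letter_act_def fun_eq_iff)

lemma letter_act_commute:
  assumes "2 \<le> n" "s \<in> {1..n + 1}" "t \<in> {1..n + 1}" "affA_matrix n s t = 2"
  shows "letter_act n s (letter_act n t c) = letter_act n t (letter_act n s c)"
proof -
  have "s \<noteq> t" "t \<noteq> s + 1" "s \<noteq> t + 1" "\<not> (s = 1 \<and> t = n + 1)" "\<not> (t = 1 \<and> s = n + 1)"
    using assms(4) by (auto simp: affA_matrix_eq split: if_splits)
  then show ?thesis
    using assms(1-3) by (auto simp: letter_act_def fun_eq_iff)
qed

lemma letter_act_braid:
  assumes "2 \<le> n" "1 \<le> s" "s \<le> n" "t = s + 1 \<or> t = n + 1 \<and> s = 1"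
  shows "letter_act n s (letter_act n t (letter_act n s c)) = letter_act n t (letter_act n s (letter_act n t c))"
proof -
  consider "t = n + 1" "s = 1" | "t = n + 1" "s = n" "s \<noteq> 1" | "t = s + 1" "s < n"
    using assms by linarith
  then show ?thesis
    by cases (use assms in \<open>simp_all add: letter_act_def fun_eq_iff\<close>)
qed

lemma word_act_relation:
  assumes n: "2 \<le> n" and st: "s \<in> {1..n + 1}" "t \<in> {1..n + 1}"
  shows "word_act n (concat (replicate (affA_matrix n s t) [s, t])) c = c"
proof -
  note sq = letter_act_square[OF n]
  have "t = s + 1 \<Longrightarrow> s \<le> n" "s = t + 1 \<Longrightarrow> t \<le> n" "1 \<le> n" using st n by auto
  then consider "s = t" | "s \<noteq> t" "\<not> (t = s + 1 \<or> s = t + 1 \<or> s = 1 \<and> t = n + 1 \<or> s = n + 1 \<and> t = 1)"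
    | "s \<noteq> t" "s \<le> n" "t = s + 1 \<or> t = n + 1 \<and> s = 1"
    | "s \<noteq> t" "t \<le> n" "s = t + 1 \<or> s = n + 1 \<and> t = 1"
    by blast
  then show ?thesis
  proof cases
    case 2
    then have M: "affA_matrix n s t = 2" by (simp add: affA_matrix_eq)
    then show ?thesis
      using letter_act_commute[OF n st M, of "letter_act n s (letter_act n t c)"]
      by (simp add: numeral_2_eq_2 sq)
  next
    case 3
    then have "affA_matrix n s t = 3" using n by (auto simp: affA_matrix_eq)
    then show ?thesis
      using letter_act_braid[OF n _ 3(2,3), of "letter_act n t (letter_act n s (letter_act n t c))"] st
      by (simp add: numeral_3_eq_3 sq)
  next
    case 4
    then have "affA_matrix n s t = 3" using n by (auto simp: affA_matrix_eq)
    then show ?thesis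
      using letter_act_braid[OF n _ 4(2,3), of "letter_act n t (letter_act n s (letter_act n t c))"] st
      by (simp add: numeral_3_eq_3 sq)
  qed (simp add: sq affA_matrix_eq)
qed

lemma word_act_cong:
  assumes "2 \<le> n" "u \<approx>\<^bsub>n\<^esub> v"
  shows "word_act n u c = word_act n v c"
  using assms(2)
proof (induction arbitrary: c rule: cox_eq.induct)
  case (cox_rel s t)
  then show ?case using word_act_relation[OF assms(1)] by simp
qed auto

text \<open>
  Take for the fundamental alcove the one where every positive root \<open>c x - c y\<close>, \<open>x < y\<close>, lies between
  \<open>-1\<close> and \<open>0\<close>. If such a root has the value \<open>d\<close> at a lattice point, its hyperplanes between the
  fundamental alcove and the nearest alcove at this point have the levels \<open>0, \<dots>, d - 1\<close> or
  \<open>d + 1, \<dots>, -1\<close>. Their number is \<open>pair_cost d\<close>, and \<open>height\<close> is the total.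
\<close>

definition pair_cost :: "int \<Rightarrow> int" where
  "pair_cost d = (if 0 \<le> d then d else - d - 1)"

definition index_pairs :: "nat \<Rightarrow> (nat \<times> nat) set" where
  "index_pairs n = {(x, y). 1 \<le> x \<and> x < y \<and> y \<le> n + 1}"

definition height :: "nat \<Rightarrow> (nat \<Rightarrow> int) \<Rightarrow> int" where
  "height n c = (\<Sum>(x, y) \<in> index_pairs n. pair_cost (c x - c y))"

lemma finite_index_pairs [simp]: "finite (index_pairs n)"
proof (rule finite_subset)
  show "index_pairs n \<subseteq> {1..n + 1} \<times> {1..n + 1}" by (auto simp: index_pairs_def)
qed simp

text \<open>
  Up to a symmetry of the cost, a generator permutes the positive roots other than its own one, so the
  height changes only there.
\<close>

lemma sum_change_at_one:
  fixes f g :: "'a \<Rightarrow> int"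
  assumes "finite A" "a \<in> A" "bij_betw \<phi> A A" "\<phi> a = a"
    and "\<And>x. x \<in> A \<Longrightarrow> x \<noteq> a \<Longrightarrow> g x = f (\<phi> x)"
  shows "sum g A = sum f A + (g a - f a)"
proof -
  have "sum f A = (\<Sum>x\<in>A. f (\<phi> x))"
    using assms(3) by (rule sum.reindex_bij_betw[symmetric])
  also have "\<dots> = f a + (\<Sum>x\<in>A - {a}. f (\<phi> x))"
    using assms by (simp add: sum.remove)
  also have "(\<Sum>x\<in>A - {a}. f (\<phi> x)) = (\<Sum>x\<in>A - {a}. g x)"
    using assms(5) by (intro sum.cong) auto
  also have "\<dots> = sum g A - g a" using assms(1,2) by (simp add: sum.remove)
  finally show ?thesis by simp
qed

text \<open>
  The transposition preserves the order of every pair of indices except \<open>(k, k + 1)\<close>.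
\<close>

lemma height_generator:
  assumes "1 \<le> k" "k \<le> n"
  shows "height n (letter_act n k c) =
    height n c + pair_cost (c (k + 1) - c k) - pair_cost (c k - c (k + 1))"
proof -
  define \<tau> where "\<tau> x = (if x = k then k + 1 else if x = k + 1 then k else x)" for x
  define \<phi> where "\<phi> p = (if p = (k, k + 1) then p else (\<tau> (fst p), \<tau> (snd p)))" for p
  have inv: "\<phi> (\<phi> p) = p" if "p \<in> index_pairs n" for p
    using that unfolding \<phi>_def \<tau>_def index_pairs_def by (auto split: if_splits)
  have mem: "\<phi> p \<in> index_pairs n" if "p \<in> index_pairs n" for p
    using that assms unfolding \<phi>_def \<tau>_def index_pairs_def by (auto split: if_splits)
  have bij: "bij_betw \<phi> (index_pairs n) (index_pairs n)"
    using inv mem by (intro bij_betw_byWitness[where f' = \<phi>]) auto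
  have act: "letter_act n k c x = c (\<tau> x)" for x
    using assms unfolding letter_act_def \<tau>_def by auto
  have "height n (letter_act n k c) = height n c +
    ((case (k, k + 1) of (x, y) \<Rightarrow> pair_cost (letter_act n k c x - letter_act n k c y))
     - (case (k, k + 1) of (x, y) \<Rightarrow> pair_cost (c x - c y)))"
    unfolding height_def using assms
    by (intro sum_change_at_one[OF finite_index_pairs _ bij]) (auto simp: index_pairs_def \<phi>_def act)
  then show ?thesis unfolding act by (simp add: \<tau>_def)
qed

text \<open>
  For a middle index \<open>x\<close> the pairs \<open>(1, x)\<close> and \<open>(x, n + 1)\<close> exchange their costs, because
  \<open>c (n + 1) - 1 - c x\<close> and \<open>c x - c (n + 1)\<close> have the same \<open>pair_cost\<close>.
\<close>

lemma height_affine: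
  assumes "2 \<le> n"
  shows "height n (letter_act n (n + 1) c) =
    height n c + pair_cost (c (n + 1) - c 1 - 2) - pair_cost (c 1 - c (n + 1))"
proof -
  define \<phi> where "\<phi> p = (if p = (1, n + 1) then p else if fst p = 1 then (snd p, n + 1)
    else if snd p = n + 1 then (1, fst p) else p)" for p
  have inv: "\<phi> (\<phi> p) = p" if "p \<in> index_pairs n" for p
    using that unfolding \<phi>_def index_pairs_def by (auto split: if_splits)
  have mem: "\<phi> p \<in> index_pairs n" if "p \<in> index_pairs n" for p
    using that assms unfolding \<phi>_def index_pairs_def by (auto split: if_splits)
  have bij: "bij_betw \<phi> (index_pairs n) (index_pairs n)"
    using inv mem by (intro bij_betw_byWitness[where f' = \<phi>]) auto
  let ?c = "letter_act n (n + 1) c"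
  have "height n ?c = height n c +
    ((case (1, n + 1) of (x, y) \<Rightarrow> pair_cost (?c x - ?c y))
     - (case (1, n + 1) of (x, y) \<Rightarrow> pair_cost (c x - c y)))"
    unfolding height_def using assms
    by (intro sum_change_at_one[OF finite_index_pairs _ bij])
      (auto simp: index_pairs_def \<phi>_def letter_act_def pair_cost_def)
  then show ?thesis using assms by (simp add: letter_act_def)
qed

lemma height_letter_le:
  assumes "2 \<le> n" "s \<in> {1..n + 1}"
  shows "height n (letter_act n s c) \<le> height n c + 1"
proof (cases "s = n + 1")
  case True
  then show ?thesis using height_affine[OF assms(1), of c] by (simp add: pair_cost_def)
next
  case False
  then show ?thesis using height_generator[of s n c] assms by (simp add: pair_cost_def)
qed

lemma height_word_le:
  assumes "2 \<le> n" "set u \<subseteq> {1..n + 1}"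
  shows "height n (word_act n u c) \<le> height n c + int (length u)"
  using assms(2)
proof (induction u)
  case (Cons s u)
  then show ?case using height_letter_le[OF assms(1), of s "word_act n u c"] by auto
qed simp

lemma height_zero: "height n (\<lambda>_. 0) = 0"
  by (simp add: height_def pair_cost_def)

section \<open>Affine blocks climb one hyperplane per letter\<close>

lemma height_ascent:
  assumes "1 \<le> k" "k \<le> n" "c k < c (k + 1)"
  shows "height n (letter_act n k c) = height n c + 1"
  using height_generator[OF assms(1,2), of c] assms(3) by (simp add: pair_cost_def)

lemma height_affine_ascent:
  assumes "2 \<le> n" "c (n + 1) \<le> c 1"
  shows "height n (letter_act n (n + 1) c) = height n c + 1"
  using height_affine[OF assms(1), of c] assms(2) by (simp add: pair_cost_def)

lemma down_word_act:
  assumes "i \<le> n"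
  shows "word_act n (down_word i 1) c =
    (\<lambda>x. if 1 \<le> x \<and> x \<le> i then c (x + 1) else if x = i + 1 then c 1 else c x)"
  using assms
proof (induction i)
  case 0
  then show ?case by auto
next
  case (Suc i)
  have "word_act n (down_word (Suc i) 1) c = letter_act n (Suc i) (word_act n (down_word i 1) c)"
    by (simp add: down_word_Cons)
  also have "word_act n (down_word i 1) c =
    (\<lambda>x. if 1 \<le> x \<and> x \<le> i then c (x + 1) else if x = i + 1 then c 1 else c x)"
    using Suc by simp
  finally show ?case
    using Suc.prems unfolding letter_act_def by (auto simp: fun_eq_iff)
qed

lemma height_down_word:
  assumes "i \<le> n" "\<And>x. 2 \<le> x \<Longrightarrow> x \<le> i + 1 \<Longrightarrow> c 1 < c x"
  shows "height n (word_act n (down_word i 1) c) = height n c + int i"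
  using assms
proof (induction i)
  case (Suc i)
  let ?e = "word_act n (down_word i 1) c"
  have "c 1 < c (Suc i + 1)" using Suc.prems(2)[of "Suc i + 1"] by simp
  then have "?e (Suc i) < ?e (Suc i + 1)"
    using Suc.prems(1) unfolding down_word_act[OF Suc_leD[OF Suc.prems(1)]] by simp
  then have "height n (letter_act n (Suc i) ?e) = height n ?e + 1"
    using Suc.prems(1) by (intro height_ascent) auto
  then show ?case using Suc by (simp add: down_word_Cons)
qed simp

lemma up_word_act:
  assumes "j \<le> n + 1" "1 \<le> j"
  shows "word_act n (up_word j n) c =
    (\<lambda>x. if x = j then c (n + 1) else if j < x \<and> x \<le> n + 1 then c (x - 1) else c x)"
  using assms
proof (induction j rule: inc_induct)
  case base
  then show ?case by auto
next
  case (step j)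
  have "word_act n (up_word j n) c = letter_act n j (word_act n (up_word (Suc j) n) c)"
    using step.hyps by (simp add: up_word_Cons[of j])
  also have "word_act n (up_word (Suc j) n) c =
    (\<lambda>x. if x = Suc j then c (n + 1) else if Suc j < x \<and> x \<le> n + 1 then c (x - 1) else c x)"
    using step by simp
  finally show ?case
    using step.hyps unfolding letter_act_def by (auto simp: fun_eq_iff)
qed

lemma height_up_word:
  assumes "j \<le> n + 1" "1 \<le> j" "\<And>x. j \<le> x \<Longrightarrow> x \<le> n \<Longrightarrow> c x < c (n + 1)"
  shows "height n (word_act n (up_word j n) c) = height n c + int (n + 1 - j)"
  using assms
proof (induction j rule: inc_induct)
  case base
  then show ?case by auto
next
  case (step j)
  let ?e = "word_act n (up_word (Suc j) n) c"
  have j: "j \<le> n" using step.hyps by simp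
  have "c j < c (n + 1)" using step.prems(2)[of j] j by simp
  then have "?e j < ?e (j + 1)" using j by (simp add: up_word_act)
  then have "height n (letter_act n j ?e) = height n ?e + 1"
    using j step.prems(1) by (intro height_ascent) auto
  moreover have "height n ?e = height n c + int (n + 1 - Suc j)"
    using step by auto
  ultimately show ?case using j by (simp add: up_word_Cons[of j])
qed

text \<open>
  The vector \<open>h(j,i) c\<close> in coordinates: the first entry moves right to position \<open>i + 1\<close>, then the last one moves
  left to position \<open>j\<close>.
\<close>

definition h_image :: "nat \<Rightarrow> nat \<Rightarrow> nat \<Rightarrow> (nat \<Rightarrow> int) \<Rightarrow> nat \<Rightarrow> int" where
  "h_image n j i c =
     (let d = (\<lambda>x. if 1 \<le> x \<and> x \<le> i then c (x + 1) else if x = i + 1 then c 1 else c x)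
      in (\<lambda>x. if x = j then d (n + 1) else if j < x \<and> x \<le> n + 1 then d (x - 1) else d x))"

lemma h_word_act:
  assumes "i < n" "1 \<le> j" "j \<le> n + 1"
  shows "word_act n (h_word n j i) c = h_image n j i c"
  unfolding h_word_def foldr_append down_word_act[OF less_imp_le_nat[OF assms(1)]]
    up_word_act[OF assms(3,2)] h_image_def Let_def ..

text \<open>
  Each letter of \<open>\<lceil>i,1\<rceil>\<close> moves the entry \<open>c 1\<close> past a larger one, and each letter of \<open>\<lfloor>j,n\<rfloor>\<close> moves the entry
  \<open>c (n + 1)\<close> past a smaller one. The index \<open>if x \<le> i then x + 1 else x\<close> is where the entry at position \<open>x\<close>
  was before the first of these two moves.
\<close>

lemma height_h_word:
  assumes "i < n" "1 \<le> j" "j \<le> n + 1"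
    and low: "\<And>x. 2 \<le> x \<Longrightarrow> x \<le> i + 1 \<Longrightarrow> c 1 < c x"
    and high: "\<And>x. j \<le> x \<Longrightarrow> x \<le> n \<Longrightarrow> x \<noteq> i + 1 \<Longrightarrow> c (if x \<le> i then x + 1 else x) < c (n + 1)"
    and low_high: "c 1 < c (n + 1)"
  shows "height n (word_act n (h_word n j i) c) = height n c + int (length (h_word n j i))"
proof -
  define d where "d = word_act n (down_word i 1) c"
  have d: "d = (\<lambda>x. if 1 \<le> x \<and> x \<le> i then c (x + 1) else if x = i + 1 then c 1 else c x)"
    using assms(1) unfolding d_def by (intro down_word_act) simp
  have dn: "d (n + 1) = c (n + 1)" using assms(1) unfolding d by simp
  have "d x < d (n + 1)" if "j \<le> x" "x \<le> n" for x
  proof (cases "x = i + 1")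
    case True
    then show ?thesis unfolding dn using low_high by (simp add: d)
  next
    case False
    then show ?thesis unfolding dn using high[OF that False] that assms(2) by (auto simp: d)
  qed
  then have "height n (word_act n (up_word j n) d) = height n d + int (n + 1 - j)"
    using assms by (intro height_up_word)
  moreover have "height n d = height n c + int i"
    using assms(1) low unfolding d_def by (intro height_down_word) auto
  moreover have "word_act n (h_word n j i) c = word_act n (up_word j n) d"
    by (simp add: h_word_def d_def)
  ultimately show ?thesis
    using assms(3) by (simp add: h_word_def of_nat_diff)
qed

text \<open>
  The invariant of blocks: for \<open>p\<close> and \<open>q\<close> of the first pair, an entry to the left of \<open>p\<close> is at least as large as any
  later entry to the right of \<open>q\<close>.
\<close>

definition dominates :: "nat \<Rightarrow> nat \<Rightarrow> nat \<Rightarrow> (nat \<Rightarrow> int) \<Rightarrow> bool" where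
  "dominates n p q c \<longleftrightarrow> (\<forall>x y. 1 \<le> x \<and> x < y \<and> y \<le> n + 1 \<and> x < p \<and> q < y \<longrightarrow> c y \<le> c x)"

text \<open>
  The image \<open>p\<close> of \<open>1\<close> under the permutation \<open>h(j,i)\<close>.
\<close>

definition first_image :: "nat \<times> nat \<Rightarrow> nat" where
  "first_image b = (if snd b + 1 < fst b then snd b + 1 else snd b + 2)"

text \<open>
  The affine letter turns the last entry into a new lowest candidate \<open>c (n + 1) - 1\<close> in front, and the first one
  into a new highest candidate \<open>c 1 + 1\<close> at the end. These travel through positions that lie to the
  left of \<open>P\<close> or to the right of \<open>Q\<close>, where the invariant makes every comparison strict. The
  invariant is inherited because all other entries keep their order, those that end up left of \<open>p\<close> come
  from the left of \<open>P\<close>, and those that end up right of \<open>j\<close> come from the right of \<open>Q\<close>.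
\<close>

lemma pair_word_act:
  assumes n: "2 \<le> n" and b: "entry_ok n (j, i)" and c: "dominates n P Q c" and PQ: "2 \<le> P" "Q \<le> n"
    and p: "p = first_image (j, i)"
    and P: "p \<le> P" "p < j \<Longrightarrow> p < P" and Q: "Q \<le> j" "p < j \<Longrightarrow> Q < j"
  shows "height n (word_act n (B_word n j i) c) = height n c + int (length (B_word n j i))
    \<and> dominates n p j (word_act n (B_word n j i) c)"
proof -
  have ij: "1 \<le> j" "j \<le> n + 1" "i < n" using b n unfolding entry_ok_def by auto
  have D: "c y \<le> c x" if "1 \<le> x" "x < y" "y \<le> n + 1" "x < P" "Q < y" for x y
    using c that unfolding dominates_def by blast
  have cases: "i + 1 < j \<and> p = i + 1 \<and> i + 1 < P \<and> Q < j \<or> j \<le> i + 1 \<and> p = i + 2 \<and> i + 1 < P \<and> Q \<le> j"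
    using P Q p unfolding first_image_def by (auto split: if_splits)
  have iP: "i + 1 < P" using cases by blast
  define d where "d = letter_act n (n + 1) c"
  have d: "d 1 = c (n + 1) - 1" "d (n + 1) = c 1 + 1" "\<And>x. 2 \<le> x \<Longrightarrow> x \<le> n \<Longrightarrow> d x = c x"
    unfolding d_def letter_act_def using n by auto
  have ends: "c (n + 1) \<le> c 1" using D[of 1 "n + 1"] n PQ by simp
  have "d 1 < d x" if "2 \<le> x" "x \<le> i + 1" for x
    using D[of x "n + 1"] that ij iP PQ d by simp
  moreover have "d (if x \<le> i then x + 1 else x) < d (n + 1)" if x: "j \<le> x" "x \<le> n" "x \<noteq> i + 1" for x
  proof (cases "x \<le> i")
    case True
    then show ?thesis using D[of 1 "x + 1"] x ij PQ Q(1) d(2) d(3)[of "x + 1"] by simp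
  next
    case False
    have "Q < x" "2 \<le> x" using cases x False by linarith+
    then show ?thesis using D[of 1 x] x False PQ d(2) d(3)[of x] by simp
  qed
  moreover have "d 1 < d (n + 1)" using ends d by simp
  ultimately have h: "height n (word_act n (h_word n j i) d) = height n d + int (length (h_word n j i))"
    using height_h_word[OF ij(3,1,2), of d] by blast
  have w: "word_act n (h_word n j i) d = h_image n j i d"
    using h_word_act[OF ij(3,1,2)] .
  have Bw: "word_act n (B_word n j i) c = word_act n (h_word n j i) d"
    by (simp add: B_word_def d_def)
  have "height n (word_act n (B_word n j i) c) = height n c + int (length (B_word n j i))"
    unfolding Bw h using height_affine_ascent[OF n ends] by (simp add: d_def B_word_def)
  moreover have "dominates n p j (word_act n (B_word n j i) c)"
    unfolding dominates_def
  proof (intro allI impI, elim conjE)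
    fix x y assume xy: "1 \<le> x" "x < y" "y \<le> n + 1" "x < p" "j < y"
    let ?f = "word_act n (B_word n j i) c"
    have f_at_j: "?f j = c 1 + 1" unfolding Bw w h_image_def Let_def using d ij by simp
    have f_high: "?f z = c z" if "j < z" "z \<le> i + 1" for z
      unfolding Bw w h_image_def Let_def using that ij d(3)[of z] by auto
    have f_low: "?f (i + 2) = c (n + 1) - 1" if "j < i + 2"
      unfolding Bw w h_image_def Let_def using that ij d(1) by simp
    have f_top: "?f z = c (z - 1)" if "j < z" "i + 2 < z" "z \<le> n + 1" for z
      unfolding Bw w h_image_def Let_def using that ij d(3)[of "z - 1"] by auto
    have f_bot: "?f z = c (z + 1)" if "1 \<le> z" "z < j" "z \<le> i" for z
      unfolding Bw w h_image_def Let_def using that ij d(3)[of "z + 1"] by auto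
    consider (asc) "i + 1 < j" "p = i + 1" "Q < j" | (desc) "j \<le> i + 1" "p = i + 2" "Q \<le> j"
      using cases by blast
    then show "?f y \<le> ?f x"
    proof cases
      case asc
      have "?f x = c (x + 1)" using f_bot xy asc by simp
      moreover have "?f y = c (y - 1)" using f_top xy asc by simp
      moreover have "c (y - 1) \<le> c (x + 1)"
        using xy asc iP by (intro D) linarith+
      ultimately show ?thesis by simp
    next
      case desc
      \<comment> \<open>The positions \<open>y'\<close> and \<open>x'\<close> in \<open>c\<close> hold bounds for the new entries at \<open>y\<close> and \<open>x\<close>.\<close>
      obtain y' where y': "?f y \<le> c y'" "y' \<le> n + 1" "j < y'" "y \<le> y' \<or> i + 2 \<le> y'"
      proof -
        consider "y \<le> i + 1" | "y = i + 2" | "i + 2 < y" by linarith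
        then show ?thesis
        proof cases
          case 1
          then show ?thesis using that[of y] f_high[of y] xy by simp
        next
          case 2
          then show ?thesis using that[of "n + 1"] f_low xy desc ij by simp
        next
          case 3
          then have "j < y - 1" "y - 1 \<le> n + 1" "i + 2 \<le> y - 1"
            using xy desc(1) by linarith+
          then show ?thesis using that[of "y - 1"] f_top[of y] 3 xy by simp
        qed
      qed
      obtain x' where x': "c x' \<le> ?f x" "1 \<le> x'" "x' < y'" "x' \<le> i + 1"
      proof -
        consider "x < j" | "x = j" | "j < x" by linarith
        then show ?thesis
        proof cases
          case 1
          then show ?thesis
            using that[of "x + 1"] f_bot[of x] xy desc y'(3) by simp
        next
          case 2
          then show ?thesis
            using that[of 1] f_at_j desc y'(3) ij by simp
        next
          case 3
          have "x < y'" using y'(4) xy desc by linarith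
          then show ?thesis
            using that[of x] f_high[of x] xy desc 3 by simp
        qed
      qed
      have "c y' \<le> c x'"
        using x' y' iP desc by (intro D) linarith+
      then show ?thesis using x'(1) y'(1) by linarith
    qed
  qed
  ultimately show ?thesis by blast
qed

lemma block_word_act:
  assumes n: "2 \<le> n" and v: "valid_block n bs"
  shows "height n (word_act n (block_word n bs) (\<lambda>_. 0)) = int (length (block_word n bs))
    \<and> (bs \<noteq> [] \<longrightarrow> dominates n (first_image (hd bs)) (fst (hd bs)) (word_act n (block_word n bs) (\<lambda>_. 0)))"
  using v
proof (induction bs)
  case Nil
  then show ?case by (simp add: height_zero)
next
  case (Cons b bs)
  have v: "entry_ok n b" "valid_block n bs" "bs \<noteq> [] \<Longrightarrow> next_ok n b (hd bs)"
    using Cons.prems n by (auto simp: valid_block_Cons)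
  obtain j i where b: "b = (j, i)" by fastforce
  let ?c = "word_act n (block_word n bs) (\<lambda>_. 0)"
  have IH: "height n ?c = int (length (block_word n bs))"
    "bs \<noteq> [] \<Longrightarrow> dominates n (first_image (hd bs)) (fst (hd bs)) ?c"
    using Cons.IH v(2) by auto
  have "height n (word_act n (B_word n j i) ?c) = height n ?c + int (length (B_word n j i))
    \<and> dominates n (first_image (j, i)) j (word_act n (B_word n j i) ?c)"
  proof (cases bs)
    case Nil
    have ij: "1 \<le> j" "i < n" using v(1) n unfolding b entry_ok_def by auto
    \<comment> \<open>The zero vector satisfies the invariant for all indices, hence with the weakest bounds on the pair.\<close>
    have "dominates n (n + 2) 0 ?c" by (simp add: Nil dominates_def)
    then show ?thesis
      using n v(1) ij unfolding b
      by (intro pair_word_act[where P = "n + 2" and Q = 0]) (auto simp: first_image_def)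
  next
    case (Cons b' bs')
    obtain j' i' where b': "b' = (j', i')" by fastforce
    have ok: "next_ok n (j, i) (j', i')" using v(3) Cons b b' by simp
    then have ok': "1 \<le> j'" "j' \<le> n" "i' < n" "i' = 0 \<longrightarrow> j' = 1" "j' \<le> j" "i \<le> i'"
      "i + 1 < j \<longrightarrow> j' < j" "i' + 1 < j' \<longrightarrow> i < i'"
      unfolding next_ok_iff[OF n] by blast+
    have P: "2 \<le> first_image (j', i')" using ok' unfolding first_image_def by auto
    have P': "first_image (j, i) \<le> first_image (j', i')"
      "first_image (j, i) < j \<Longrightarrow> first_image (j, i) < first_image (j', i')"
      "first_image (j, i) < j \<Longrightarrow> j' < j"
      using ok' unfolding first_image_def by (auto split: if_splits)
    show ?thesis
      using n v(1) ok' P P' IH(2) unfolding b by (intro pair_word_act[where Q = j' and P = "first_image (j', i')"])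
        (auto simp: Cons b')
  qed
  then show ?case using IH by (simp add: b)
qed

section \<open>Lengths and minimal coset representatives\<close>

lemma word_elem_eq_iff:
  assumes "set u \<subseteq> {1..n + 1}"
  shows "word_elem n u = word_elem n v \<longleftrightarrow> u \<approx>\<^bsub>n\<^esub> v"
  unfolding word_elem_def using assms by (intro cox_elem_eq_iff) (auto simp: lists_eq_set)

lemma word_elem_mult:
  assumes "set u \<subseteq> {1..n + 1}" "set v \<subseteq> {1..n + 1}"
  shows "word_elem n u \<otimes>\<^bsub>WA_aff n\<^esub> word_elem n v = word_elem n (u @ v)"
  unfolding word_elem_def WA_aff_def using assms by (intro mult_cox_elem) (auto simp: lists_eq_set)

lemma word_elem_Nil: "word_elem n [] = \<one>\<^bsub>WA_aff n\<^esub>"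
  by (simp add: word_elem_def WA_aff_def one_cox_group)

lemma word_elem_carrier:
  assumes "set u \<subseteq> {1..n + 1}"
  shows "word_elem n u \<in> carrier (WA_aff n)"
  unfolding word_elem_def WA_aff_def carrier_cox_group
  using assms by (intro imageI) (auto simp: lists_eq_set)

lemma len_le:
  assumes "set u \<subseteq> {1..n + 1}"
  shows "len n (word_elem n u) \<le> length u"
  unfolding len_def cox_length_def word_elem_def
  using assms by (intro Least_le bexI[of _ u]) (auto simp: lists_eq_set)

lemma len_attained:
  assumes "set u \<subseteq> {1..n + 1}"
  obtains v where "set v \<subseteq> {1..n + 1}" "u \<approx>\<^bsub>n\<^esub> v" "length v = len n (word_elem n u)"
proof -
  let ?P = "\<lambda>k. \<exists>v\<in>lists {1..n + 1}. cox_elem {1..n + 1} (affA_matrix n) v = word_elem n u \<and> length v = k"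
  have "?P (length u)"
    using assms by (intro bexI[of _ u]) (auto simp: lists_eq_set word_elem_def)
  then have "?P (LEAST k. ?P k)" by (rule LeastI)
  then obtain v where "v \<in> lists {1..n + 1}" "word_elem n v = word_elem n u"
    "length v = len n (word_elem n u)"
    unfolding len_def cox_length_def word_elem_def by blast
  then show ?thesis
    using that[of v] word_elem_eq_iff[OF assms, of v] by (auto simp: lists_eq_set)
qed

lemma height_le_len:
  assumes "2 \<le> n" "set u \<subseteq> {1..n + 1}"
  shows "height n (word_act n u (\<lambda>_. 0)) \<le> int (len n (word_elem n u))"
proof -
  obtain v where v: "set v \<subseteq> {1..n + 1}" "u \<approx>\<^bsub>n\<^esub> v" "length v = len n (word_elem n u)"
    using len_attained[OF assms(2)] .
  show ?thesis
    using height_word_le[OF assms(1) v(1), of "\<lambda>_. 0"] v(3) word_act_cong[OF assms(1) v(2)]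
    by (simp add: height_zero)
qed

text \<open>
  The height bounds the length from below, and block words attain this bound.
\<close>

lemma len_block_word:
  assumes "2 \<le> n" "valid_block n bs"
  shows "len n (word_elem n (block_word n bs)) = length (block_word n bs)"
proof (rule antisym)
  note S = set_block_word[OF assms]
  show "len n (word_elem n (block_word n bs)) \<le> length (block_word n bs)"
    using len_le[OF S] .
  show "length (block_word n bs) \<le> len n (word_elem n (block_word n bs))"
    using height_le_len[OF assms(1) S] block_word_act[OF assms] by simp
qed

lemma even_length_cong:
  assumes "u \<approx>\<^bsub>n\<^esub> v"
  shows "even (length u) \<longleftrightarrow> even (length v)"
  using assms
proof (induction rule: cox_eq.induct)
  case (cox_rel s t)
  then show ?case by (auto simp: length_concat sum_list_replicate)
qed auto

lemma even_len_iff: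
  assumes "set u \<subseteq> {1..n + 1}"
  shows "even (len n (word_elem n u)) \<longleftrightarrow> even (length u)"
  using len_attained[OF assms] even_length_cong by metis

lemma word_act_zero:
  assumes "set u \<subseteq> {1..n}"
  shows "word_act n u (\<lambda>_. 0) = (\<lambda>_. 0)"
  using assms
proof (induction u)
  case (Cons s u)
  then show ?case by (auto simp: letter_act_def fun_eq_iff)
qed simp

lemma WA_word:
  assumes "x \<in> WA n"
  obtains u where "set u \<subseteq> {1..n}" "x = word_elem n u"
proof -
  have sub: "{1..n} \<subseteq> {1..n + 1}" by auto
  have "\<exists>u. set u \<subseteq> {1..n} \<and> x = word_elem n u"
    using assms unfolding WA_def
  proof (induction rule: generate.induct)
    case one
    then show ?case by (intro exI[of _ "[]"]) (simp add: word_elem_Nil)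
  next
    case (incl h)
    then obtain k where "k \<in> {1..n}" "h = word_elem n [k]" by (auto simp: \<sigma>_def)
    then show ?case by (intro exI[of _ "[k]"]) auto
  next
    case (inv h)
    then obtain k where k: "k \<in> {1..n}" "h = word_elem n [k]" by (auto simp: \<sigma>_def)
    have "word_elem n [k] \<otimes>\<^bsub>WA_aff n\<^esub> word_elem n [k] = \<one>\<^bsub>WA_aff n\<^esub>"
      using k affA.square_eq_Nil[of k n]
      by (subst word_elem_mult) (auto simp: word_elem_eq_iff word_elem_Nil[symmetric])
    then have "inv\<^bsub>WA_aff n\<^esub> h = h"
      using k by (intro group.inv_equality[OF group_WA_aff]) (auto intro!: word_elem_carrier)
    then show ?case using k by (intro exI[of _ "[k]"]) auto
  next
    case (eng h1 h2)
    then obtain u v where uv: "set u \<subseteq> {1..n}" "h1 = word_elem n u" "set v \<subseteq> {1..n}" "h2 = word_elem n v"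
      by blast
    have "h1 \<otimes>\<^bsub>WA_aff n\<^esub> h2 = word_elem n (u @ v)"
      unfolding uv(2,4) using uv(1,3) sub by (intro word_elem_mult) blast+
    then show ?case using uv(1,3) by (intro exI[of _ "u @ v"]) simp
  qed
  then show ?thesis using that by blast
qed

lemma word_elem_in_WA:
  assumes "set u \<subseteq> {1..n}"
  shows "word_elem n u \<in> WA n"
  using assms
proof (induction u)
  case Nil
  then show ?case by (simp add: WA_def word_elem_Nil generate.one)
next
  case (Cons k u)
  have "word_elem n (k # u) = \<sigma> n k \<otimes>\<^bsub>WA_aff n\<^esub> word_elem n u"
    using Cons.prems word_elem_mult[of "[k]" n u] unfolding \<sigma>_def by fastforce
  moreover have "\<sigma> n k \<in> WA n"
    using Cons.prems by (auto simp: WA_def intro!: generate.incl)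
  ultimately show ?case
    using Cons unfolding WA_def by (auto intro: generate.eng)
qed

text \<open>
  All elements of the coset send the origin to the same vector, and its height already forces the
  length of the block word.
\<close>

lemma minimal_block:
  assumes n: "2 \<le> n" and v: "valid_block n bs"
  shows "minimal_in_coset n (word_elem n (block_word n bs))"
  unfolding minimal_in_coset_def
proof
  let ?w = "block_word n bs"
  fix x assume "x \<in> word_elem n ?w <#\<^bsub>WA_aff n\<^esub> WA n"
  then obtain y where "y \<in> WA n" "x = word_elem n ?w \<otimes>\<^bsub>WA_aff n\<^esub> y"
    by (auto simp: l_coset_def)
  moreover obtain u where u: "set u \<subseteq> {1..n}" "y = word_elem n u"
    using WA_word[OF \<open>y \<in> WA n\<close>] .
  have u': "set u \<subseteq> {1..n + 1}" using u(1) by auto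
  note S = set_block_word[OF n v]
  ultimately have x: "x = word_elem n (?w @ u)"
    using u(2) word_elem_mult[OF S u'] by simp
  have "height n (word_act n (?w @ u) (\<lambda>_. 0)) = int (length ?w)"
    using block_word_act[OF n v] by (simp add: word_act_zero[OF u(1)])
  then show "len n (word_elem n ?w) \<le> len n x"
    using height_le_len[OF n, of "?w @ u"] S u' unfolding x len_block_word[OF n v] by simp
qed

text \<open>
  Minimality gives \<open>l(w \<sigma>\<^sub>k) \<ge> l(w)\<close>, and equality is impossible because all defining relations
  have even length.
\<close>

lemma not_minimal_if_absorbed:
  assumes n: "2 \<le> n" and v: "valid_block n bs" and k: "k \<in> {1..n}"
  shows "\<not> minimal_in_coset n (word_elem n (block_word n bs @ [k]))
    \<and> len n (word_elem n (block_word n bs @ [k])) = len n (word_elem n (block_word n bs)) + 1"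
proof -
  let ?w = "block_word n bs"
  note S = set_block_word[OF n v]
  have k': "set [k] \<subseteq> {1..n + 1}" and wk: "set (?w @ [k]) \<subseteq> {1..n + 1}" using k S by auto
  have kWA: "word_elem n [k] \<in> WA n" using k by (intro word_elem_in_WA) auto
  have "word_elem n (?w @ [k]) \<in> word_elem n ?w <#\<^bsub>WA_aff n\<^esub> WA n"
    using kWA word_elem_mult[OF S k'] unfolding l_coset_def by auto
  then have "len n (word_elem n ?w) \<le> len n (word_elem n (?w @ [k]))"
    using minimal_block[OF n v] unfolding minimal_in_coset_def by blast
  moreover have "len n (word_elem n (?w @ [k])) \<le> length ?w + 1"
    using len_le[OF wk] by simp
  moreover have "len n (word_elem n (?w @ [k])) \<noteq> length ?w"
    using even_len_iff[OF wk] by auto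
  ultimately have l: "len n (word_elem n (?w @ [k])) = len n (word_elem n ?w) + 1"
    using len_block_word[OF n v] by simp
  have "?w @ [k, k] \<approx>\<^bsub>n\<^esub> ?w @ []"
    using k S by (intro affA.cong_left affA.square_eq_Nil) auto
  then have "word_elem n (?w @ [k]) \<otimes>\<^bsub>WA_aff n\<^esub> word_elem n [k] = word_elem n ?w"
    using word_elem_mult[OF wk k'] word_elem_eq_iff[of "?w @ [k, k]" n ?w] wk k' by simp
  then have "word_elem n ?w \<in> word_elem n (?w @ [k]) <#\<^bsub>WA_aff n\<^esub> WA n"
    using kWA unfolding l_coset_def by auto
  then show ?thesis using l unfolding minimal_in_coset_def by fastforce
qed

lemma h_word_letters:
  assumes "1 \<le> j" "i < n"
  shows "set (h_word n j i) \<subseteq> {1..n}"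
  using assms by (auto simp: h_word_def)

text \<open>
  A prefix of a reduced word is reduced, and \<open>h(j,i) a\<close> is a block.
\<close>

lemma len_h_word:
  assumes n: "2 \<le> n" and b: "entry_ok n (j, i)"
  shows "len n (word_elem n (h_word n j i)) = length (h_word n j i)"
proof (rule antisym)
  have S: "set (h_word n j i) \<subseteq> {1..n + 1}"
    using h_word_letters[of j i n] b n unfolding entry_ok_def by fastforce
  then show "len n (word_elem n (h_word n j i)) \<le> length (h_word n j i)" by (rule len_le)
  obtain v where v: "set v \<subseteq> {1..n + 1}" "h_word n j i \<approx>\<^bsub>n\<^esub> v"
    "length v = len n (word_elem n (h_word n j i))"
    using len_attained[OF S] .
  have "h_word n j i @ [n + 1] \<approx>\<^bsub>n\<^esub> v @ [n + 1]" using v(2) by (intro affA.cong_right) auto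
  then have "word_elem n (block_word n [(j, i)]) = word_elem n (v @ [n + 1])"
    using S by (subst word_elem_eq_iff) (auto simp: B_word_def)
  moreover have "len n (word_elem n (v @ [n + 1])) \<le> length (v @ [n + 1])"
    using v(1) by (intro len_le) auto
  ultimately show "length (h_word n j i) \<le> len n (word_elem n (h_word n j i))"
    using len_block_word[OF n, of "[(j, i)]"] b v(3) by (simp add: valid_block_single B_word_def)
qed

lemma word_act_fixed_point:
  assumes "\<And>s. s \<in> set u \<Longrightarrow> letter_act n s c = c"
  shows "word_act n u c = c"
  using assms by (induction u) auto

text \<open>
  Words without the letter \<open>1\<close> fix the vector \<open>(-1, 0, \<dots>, 0)\<close>, and words without the letter \<open>n\<close> fix
  \<open>(0, \<dots>, 0, 1)\<close>. So \<open>\<sigma>\<^sub>1\<close> and \<open>\<sigma>\<^sub>n\<close> occur in every expression of an element that moves both vectors,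
  even in those that use the affine letter. Conversely \<open>h(j,i)\<close> itself is a reduced word, and it lacks
  \<open>\<sigma>\<^sub>1\<close> or \<open>\<sigma>\<^sub>n\<close> in the remaining cases.
\<close>

lemma extremal_h_word_iff:
  assumes n: "2 \<le> n" and b: "entry_ok n (j, i)"
  shows "extremal n (word_elem n (h_word n j i)) \<longleftrightarrow> i = 0 \<and> j = 1 \<or> 1 \<le> i \<and> j \<le> n"
proof
  have ij: "1 \<le> j" "j \<le> n + 1" "i < n" using b n unfolding entry_ok_def by auto
  let ?h = "h_word n j i"
  have S: "set ?h \<subseteq> {1..n}" "set ?h \<subseteq> {1..n + 1}"
    using h_word_letters[of j i n] ij by fastforce+
  show "i = 0 \<and> j = 1 \<or> 1 \<le> i \<and> j \<le> n" if "extremal n (word_elem n ?h)"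
  proof -
    have "reduced_expr {1..n + 1} (affA_matrix n) ?h (word_elem n ?h)"
      using S(2) len_h_word[OF n b] unfolding reduced_expr_def len_def
      by (auto simp: word_elem_def lists_eq_set)
    then have "1 \<in> set ?h" "n \<in> set ?h" using that unfolding extremal_def by blast+
    then show ?thesis using ij by (auto simp: h_word_def)
  qed
  show "extremal n (word_elem n ?h)" if ext: "i = 0 \<and> j = 1 \<or> 1 \<le> i \<and> j \<le> n"
    unfolding extremal_def
  proof (intro conjI allI impI)
    show "word_elem n ?h \<in> WA n" using S(1) by (rule word_elem_in_WA)
    fix u assume "reduced_expr {1..n + 1} (affA_matrix n) u (word_elem n ?h)"
    then have u: "set u \<subseteq> {1..n + 1}" "word_elem n u = word_elem n ?h"
      unfolding reduced_expr_def by (auto simp: word_elem_def lists_eq_set)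
    then have act: "word_act n u c = h_image n j i c" for c
      using word_act_cong[OF n] h_word_act[OF ij(3,1,2)] word_elem_eq_iff[OF u(1), of ?h] by auto
    show "1 \<in> set u"
    proof (rule ccontr)
      assume no: "1 \<notin> set u"
      let ?c = "\<lambda>x. if x = 1 then - 1 else 0 :: int"
      have "word_act n u ?c = ?c"
      proof (rule word_act_fixed_point)
        fix s assume "s \<in> set u"
        then have "2 \<le> s" "s \<le> n + 1" using u(1) no by (force simp: Suc_le_eq le_eq_less_or_eq)+
        then show "letter_act n s ?c = ?c"
          using n by (auto simp: letter_act_def fun_eq_iff)
      qed
      then have "h_image n j i ?c 1 = - 1" unfolding act by simp
      then show False using ext ij n by (auto simp: h_image_def Let_def split: if_splits)
    qed
    show "n \<in> set u"
    proof (rule ccontr)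
      assume no: "n \<notin> set u"
      let ?c = "\<lambda>x. if x = n + 1 then 1 else 0 :: int"
      have "word_act n u ?c = ?c"
      proof (rule word_act_fixed_point)
        fix s assume "s \<in> set u"
        then have "1 \<le> s" "s \<le> n + 1" "s \<noteq> n" using u(1) no by auto
        then show "letter_act n s ?c = ?c"
          using n by (auto simp: letter_act_def fun_eq_iff)
      qed
      then have "h_image n j i ?c (n + 1) = 1" unfolding act by simp
      then show False using ext ij n by (auto simp: h_image_def Let_def split: if_splits)
    qed
  qed
qed

section \<open>Left multiplication of an affine block by a generator\<close>

lemma valid_block_nth:
  assumes "2 \<le> n" "valid_block n bs" "r < length bs"
  shows "entry_ok n (bs ! r)"
  using assms(2,3)
proof (induction bs arbitrary: r)
  case (Cons b bs)
  then show ?case using assms(1) by (cases r) (auto simp: valid_block_Cons)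
qed simp

lemma length_block_word_update:
  assumes "r < length bs"
  shows "length (block_word n (bs[r := b'])) + length (pair_word n (bs ! r)) =
    length (block_word n bs) + length (pair_word n b')"
  using assms
proof (induction bs arbitrary: r)
  case (Cons b bs)
  show ?case
  proof (cases r)
    case (Suc k)
    then show ?thesis using Cons.IH[of k] Cons.prems by simp
  qed simp
qed simp

lemma length_pair_word:
  assumes "entry_ok n b"
  shows "length (pair_word n b) + fst b = n + 2 + snd b"
  using assms unfolding entry_ok_def by (simp add: B_word_def h_word_def)

text \<open>
  Here \<open>h(j,i) a\<close> is the path \<open>\<lfloor>j,n\<rfloor> a\<close> or \<open>\<lceil>i,1\<rceil> a\<close>. The affine letter crosses it and meets the tail of the block
  as \<open>\<sigma>\<^sub>n\<close> or \<open>\<sigma>\<^sub>1\<close>.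
\<close>

lemma affine_letter_outcome:
  assumes n: "2 \<le> n" and v: "valid_block n ((j, i) # rest)"
    and h: "i = 0 \<and> 2 \<le> j \<and> j \<le> n \<or> 1 \<le> i \<and> j = n + 1"
  shows "letter_outcome n (n + 1) ((j, i) # rest)"
proof -
  have v': "entry_ok n (j, i)" "valid_block n rest" "rest \<noteq> [] \<Longrightarrow> next_ok n (j, i) (hd rest)"
    using v n by (auto simp: valid_block_Cons)
  have i: "i < n" using v'(1) n unfolding entry_ok_def by auto
  have "\<exists>v. 1 \<le> v \<and> v \<le> n \<and> [n + 1] @ B_word n j i \<approx>\<^bsub>n\<^esub> B_word n j i @ [v]
      \<and> (rest \<noteq> [] \<longrightarrow> next_ok n (j, i) (moved_pair v (hd rest)))"
  proof (cases "i = 0")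
    case True
    then have j: "2 \<le> j" "j \<le> n" using h by auto
    have "[n + 1] @ (up_word j n @ [n + 1]) \<approx>\<^bsub>n\<^esub> (up_word j n @ [n + 1]) @ [n]"
      using affA.path_shift[OF path_up_word_affine[of j n], of "n - j"] j
      by (simp add: nth_append nth_up_word Suc_diff_le)
    moreover have "next_ok n (j, i) (moved_pair n (hd rest))" if "rest \<noteq> []"
    proof -
      obtain j' i' where b': "hd rest = (j', i')" by fastforce
      have ok: "next_ok n (j, i) (j', i')" using v'(3)[OF that] b' by simp
      then have "j' < j" using True j unfolding next_ok_iff[OF n] by simp
      then show ?thesis
        using next_ok_moved_last[OF n ok] True n j unfolding b' by simp
    qed
    ultimately show ?thesis
      using True n by (intro exI[of _ n]) (simp add: B_word_def h_word_def)
  next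
    case False
    then have ij: "1 \<le> i" "j = n + 1" using h by auto
    have "[n + 1] @ (down_word i 1 @ [n + 1]) \<approx>\<^bsub>n\<^esub> (down_word i 1 @ [n + 1]) @ [1]"
      using affA.path_shift[OF path_down_word_affine[OF i], of "i - 1"] ij
      by (simp add: nth_append nth_down_word)
    moreover have "next_ok n (j, i) (moved_pair 1 (hd rest))" if "rest \<noteq> []"
    proof -
      obtain j' i' where b': "hd rest = (j', i')" by fastforce
      have ok: "next_ok n (j, i) (j', i')" using v'(3)[OF that] b' by simp
      then show ?thesis
        using next_ok_moved_first[OF n ok] ij n unfolding b' by simp
    qed
    ultimately show ?thesis
      using ij n by (intro exI[of _ 1]) (simp add: B_word_def h_word_def)
  qed
  then obtain v where v: "1 \<le> v" "v \<le> n" "[n + 1] @ B_word n j i \<approx>\<^bsub>n\<^esub> B_word n j i @ [v]"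
    "rest \<noteq> [] \<Longrightarrow> next_ok n (j, i) (moved_pair v (hd rest))"
    by blast
  have "letter_outcome n (n + 1) ([(j, i)] @ rest)"
    using v letter_outcome_generator[OF n v(1,2) v'(2)] assms(2) n
    by (intro letter_outcome_append[where v = v]) auto
  then show ?thesis by simp
qed

text \<open>
  The direction of the change follows from the lengths, since \<open>B(j,i)\<close> has \<open>n + 2 - j + i\<close> letters and
  block words are reduced.
\<close>

lemma letter_outcome_elem:
  assumes n: "2 \<le> n" and v: "valid_block n bs" and k: "k \<in> {1..n + 1}"
    and out: "letter_outcome n k bs"
  defines "w \<equiv> word_elem n (block_word n bs)" and "sw \<equiv> word_elem n ([k] @ block_word n bs)"
  shows "\<not> minimal_in_coset n sw \<and> len n sw = len n w + 1
      \<and> (\<exists>v\<in>{1..n}. sw = w \<otimes>\<^bsub>WA_aff n\<^esub> \<sigma> n v)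
    \<or> minimal_in_coset n sw \<and> (\<exists>r<length bs. \<exists>b'.
        valid_block n (bs[r := b']) \<and> sw = word_elem n (block_word n (bs[r := b'])) \<and>
        (fst b' \<noteq> fst (bs ! r) \<and> snd b' = snd (bs ! r) \<or> fst b' = fst (bs ! r) \<and> snd b' \<noteq> snd (bs ! r)) \<and>
        (len n sw = len n w + 1 \<longrightarrow> fst b' + 1 = fst (bs ! r) \<or> snd b' = snd (bs ! r) + 1) \<and>
        (len n sw + 1 = len n w \<longrightarrow> fst b' = fst (bs ! r) + 1 \<or> snd b' + 1 = snd (bs ! r)))"
proof -
  note S = set_block_word[OF n v]
  have kS: "set ([k] @ block_word n bs) \<subseteq> {1..n + 1}" using S k by auto
  from out consider u where "u \<in> {1..n}" "[k] @ block_word n bs \<approx>\<^bsub>n\<^esub> block_word n bs @ [u]"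
    | r b' where "r < length bs" "unit_change (bs ! r) b'" "valid_block n (bs[r := b'])"
        "[k] @ block_word n bs \<approx>\<^bsub>n\<^esub> block_word n (bs[r := b'])"
    unfolding letter_outcome_def by blast
  then show ?thesis
  proof cases
    case (1 u)
    have sw: "sw = word_elem n (block_word n bs @ [u])"
      unfolding sw_def using 1(2) by (simp only: word_elem_eq_iff[OF kS])
    moreover have "set [u] \<subseteq> {1..n + 1}" using 1(1) by auto
    ultimately have "sw = w \<otimes>\<^bsub>WA_aff n\<^esub> \<sigma> n u"
      unfolding w_def \<sigma>_def by (simp only: word_elem_mult[OF S])
    then show ?thesis
      using not_minimal_if_absorbed[OF n v 1(1)] 1(1) unfolding sw[symmetric] w_def[symmetric] by blast
  next
    case (2 r b')
    have sw: "sw = word_elem n (block_word n (bs[r := b']))"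
      unfolding sw_def using 2(4) by (simp only: word_elem_eq_iff[OF kS])
    have l: "len n w = length (block_word n bs)" "len n sw = length (block_word n (bs[r := b']))"
      unfolding w_def sw using len_block_word[OF n] v 2(3) by blast+
    have e: "entry_ok n (bs ! r)" "entry_ok n b'"
      using valid_block_nth[OF n v 2(1)] valid_block_nth[OF n 2(3), of r] 2(1) by auto
    have d: "len n sw + fst b' + snd (bs ! r) = len n w + fst (bs ! r) + snd b'"
      using length_block_word_update[OF 2(1), of n b'] length_pair_word[OF e(1)] length_pair_word[OF e(2)]
      unfolding l by linarith
    have "minimal_in_coset n sw" unfolding sw using minimal_block[OF n 2(3)] .
    moreover have "fst b' \<noteq> fst (bs ! r) \<and> snd b' = snd (bs ! r) \<or> fst b' = fst (bs ! r) \<and> snd b' \<noteq> snd (bs ! r)"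
      "len n sw = len n w + 1 \<Longrightarrow> fst b' + 1 = fst (bs ! r) \<or> snd b' = snd (bs ! r) + 1"
      "len n sw + 1 = len n w \<Longrightarrow> fst b' = fst (bs ! r) + 1 \<or> snd b' + 1 = snd (bs ! r)"
      using 2(2) d unfolding unit_change_def by linarith+
    ultimately show ?thesis using 2(1,3) sw by blast
  qed
qed

lemma h_word_trivial_iff:
  assumes n: "2 \<le> n" and b: "entry_ok n (j, i)"
  shows "word_elem n (h_word n j i) = \<one>\<^bsub>WA_aff n\<^esub> \<longleftrightarrow> i = 0 \<and> j = n + 1"
proof
  have "len n (word_elem n []) = 0" using len_le[of "[]" n] by simp
  moreover assume "word_elem n (h_word n j i) = \<one>\<^bsub>WA_aff n\<^esub>"
  ultimately have "length (h_word n j i) = 0"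
    using len_h_word[OF n b] by (simp add: word_elem_Nil)
  then show "i = 0 \<and> j = n + 1" using b by (auto simp: h_word_def entry_ok_def)
next
  assume "i = 0 \<and> j = n + 1"
  then show "word_elem n (h_word n j i) = \<one>\<^bsub>WA_aff n\<^esub>"
    by (simp add: h_word_def word_elem_Nil)
qed

theorem theorem4p2:
  fixes n m j1 i1 :: nat
    and bs rest :: "(nat \<times> nat) list"
    and w s sw :: "nat list set"
  assumes "n \<ge> 2" and "m \<ge> 1"
    and "affine_block n bs" and "length bs = m" and "bs = (j1, i1) # rest"
    and "w = block_elem n bs"
    and "s \<in> gens n"
    and "sw = s \<otimes>\<^bsub>WA_aff n\<^esub> w"
  shows
    "(\<not> minimal_in_coset n sw \<and>
        len n sw = len n w + 1 \<and>
        (\<exists>v\<in>{1..n}. sw = w \<otimes>\<^bsub>WA_aff n\<^esub> \<sigma> n v))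
     \<or>
     (minimal_in_coset n sw \<and>
       ((s = a_gen n \<and> word_elem n (h_word n j1 i1) = \<one>\<^bsub>WA_aff n\<^esub> \<and>
           (if m = 1 then sw = \<one>\<^bsub>WA_aff n\<^esub>
            else affine_block n rest \<and> sw = block_elem n rest))
        \<or>
        (s = a_gen n \<and> extremal n (word_elem n (h_word n j1 i1)) \<and>
           affine_block n ((n + 1, 0) # bs) \<and> sw = block_elem n ((n + 1, 0) # bs))
        \<or>
        (\<not> (s = a_gen n \<and> word_elem n (h_word n j1 i1) = \<one>\<^bsub>WA_aff n\<^esub>) \<and>
         \<not> (s = a_gen n \<and> extremal n (word_elem n (h_word n j1 i1))) \<and>
         (\<exists>bs'. length bs' = m \<and> affine_block n bs' \<and> sw = block_elem n bs' \<and>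
            (\<exists>r<m.
               (\<forall>t<m. t \<noteq> r \<longrightarrow> bs' ! t = bs ! t) \<and>
               (fst (bs' ! r) \<noteq> fst (bs ! r) \<and> snd (bs' ! r) = snd (bs ! r) \<or>
                fst (bs' ! r) = fst (bs ! r) \<and> snd (bs' ! r) \<noteq> snd (bs ! r)) \<and>
               (len n sw = len n w + 1 \<longrightarrow>
                  fst (bs' ! r) + 1 = fst (bs ! r) \<or> snd (bs' ! r) = snd (bs ! r) + 1) \<and>
               (len n sw + 1 = len n w \<longrightarrow>
                  fst (bs' ! r) = fst (bs ! r) + 1 \<or> snd (bs' ! r) + 1 = snd (bs ! r)))))))"
proof -
  note n = \<open>n \<ge> 2\<close>
  let ?u = "block_word n bs" and ?h = "word_elem n (h_word n j1 i1)"
  have v: "valid_block n bs" using assms(3) by (simp add: affine_block_iff_valid_block)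
  have b1: "entry_ok n (j1, i1)" and rest: "valid_block n rest"
    using v n unfolding assms(5) by (auto simp: valid_block_Cons)
  have w: "w = word_elem n ?u" using assms(6) by (simp add: block_elem_def)
  note S = set_block_word[OF n v]
  obtain k where k: "k \<in> {1..n + 1}" "s = word_elem n [k]" "k = n + 1 \<or> s \<noteq> a_gen n"
  proof (cases "s = a_gen n")
    case True
    then show ?thesis using that[of "n + 1"] by (simp add: a_gen_def)
  next
    case False
    then have "s \<in> \<sigma> n ` {1..n}" using assms(7) unfolding gens_def by blast
    then obtain k where "k \<in> {1..n}" "s = \<sigma> n k" by blast
    then show ?thesis using that[of k] False by (simp add: \<sigma>_def)
  qed
  have sw: "sw = word_elem n ([k] @ ?u)"
    using assms(8) k word_elem_mult[of "[k]" n ?u] S unfolding w k(2) by simp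
  \<comment> \<open>Outside the two special cases the outcome for the letter is all that is needed.\<close>
  have generic: ?thesis if out: "letter_outcome n k bs"
    and c: "\<not> (s = a_gen n \<and> ?h = \<one>\<^bsub>WA_aff n\<^esub>)" "\<not> (s = a_gen n \<and> extremal n ?h)"
  proof -
    note o = letter_outcome_elem[OF n v k(1) out, folded w sw]
    show ?thesis
    proof (cases "minimal_in_coset n sw")
      case False
      then show ?thesis using o by blast
    next
      case True
      then obtain r b' where r: "r < length bs" "valid_block n (bs[r := b'])"
        "sw = word_elem n (block_word n (bs[r := b']))"
        "fst b' \<noteq> fst (bs ! r) \<and> snd b' = snd (bs ! r) \<or> fst b' = fst (bs ! r) \<and> snd b' \<noteq> snd (bs ! r)"
        "len n sw = len n w + 1 \<longrightarrow> fst b' + 1 = fst (bs ! r) \<or> snd b' = snd (bs ! r) + 1"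
        "len n sw + 1 = len n w \<longrightarrow> fst b' = fst (bs ! r) + 1 \<or> snd b' + 1 = snd (bs ! r)"
        using o by blast
      have at: "bs[r := b'] ! r = b'" using r(1) by simp
      have "affine_block n (bs[r := b'])"
        using r(1,2) by (auto simp: affine_block_iff_valid_block)
      moreover have "length (bs[r := b']) = m" "\<forall>t<m. t \<noteq> r \<longrightarrow> bs[r := b'] ! t = bs ! t" "r < m"
        using assms(4) r(1) by auto
      moreover have "sw = block_elem n (bs[r := b'])" using r(3) by (simp add: block_elem_def)
      ultimately have "\<exists>bs'. length bs' = m \<and> affine_block n bs' \<and> sw = block_elem n bs' \<and>
            (\<exists>r<m.
               (\<forall>t<m. t \<noteq> r \<longrightarrow> bs' ! t = bs ! t) \<and>
               (fst (bs' ! r) \<noteq> fst (bs ! r) \<and> snd (bs' ! r) = snd (bs ! r) \<or>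
                fst (bs' ! r) = fst (bs ! r) \<and> snd (bs' ! r) \<noteq> snd (bs ! r)) \<and>
               (len n sw = len n w + 1 \<longrightarrow>
                  fst (bs' ! r) + 1 = fst (bs ! r) \<or> snd (bs' ! r) = snd (bs ! r) + 1) \<and>
               (len n sw + 1 = len n w \<longrightarrow>
                  fst (bs' ! r) = fst (bs ! r) + 1 \<or> snd (bs' ! r) + 1 = snd (bs ! r)))"
        using r(4-6) at by (intro exI[of _ "bs[r := b']"] conjI exI[of _ r]) simp_all
      then show ?thesis using True c by blast
    qed
  qed
  show ?thesis
  proof (cases "s = a_gen n")
    case False
    then have "k \<noteq> n + 1" using k(2) by (auto simp: a_gen_def)
    then have "letter_outcome n k bs"
      using letter_outcome_generator[OF n _ _ v, of k] k(1) by auto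
    then show ?thesis using generic False by blast
  next
    case True
    then have k_eq: "k = n + 1" using k(3) by blast
    consider (trivial) "i1 = 0" "j1 = n + 1"
      | (ext) "i1 = 0 \<and> j1 = 1 \<or> 1 \<le> i1 \<and> j1 \<le> n"
      | (other) "i1 = 0 \<and> 2 \<le> j1 \<and> j1 \<le> n \<or> 1 \<le> i1 \<and> j1 = n + 1"
      using b1 unfolding entry_ok_def by fastforce
    then show ?thesis
    proof cases
      case trivial
      have "[k] @ ?u = [n + 1, n + 1] @ block_word n rest"
        using trivial by (simp add: k_eq assms(5) B_word_def h_word_def)
      also have "\<dots> \<approx>\<^bsub>n\<^esub> [] @ block_word n rest"
        using set_block_word[OF n rest] by (intro affA.cong_right affA.square_eq_Nil) auto
      finally have sw': "sw = word_elem n (block_word n rest)"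
        unfolding sw using S k(1) by (subst word_elem_eq_iff) auto
      have "minimal_in_coset n sw" unfolding sw' using minimal_block[OF n rest] .
      moreover have "?h = \<one>\<^bsub>WA_aff n\<^esub>" using trivial h_word_trivial_iff[OF n b1] by simp
      moreover have "if m = 1 then sw = \<one>\<^bsub>WA_aff n\<^esub> else affine_block n rest \<and> sw = block_elem n rest"
        using assms(4,5) rest sw'
        by (auto simp: word_elem_Nil block_elem_def affine_block_iff_valid_block)
      ultimately show ?thesis using True by blast
    next
      case ext
      have ext': "extremal n ?h" using ext extremal_h_word_iff[OF n b1] by simp
      have "next_ok n (n + 1, 0) (j1, i1)"
        using ext b1 n unfolding entry_ok_def next_ok_def by auto
      then have v': "valid_block n ((n + 1, 0) # bs)"
        using v n unfolding valid_block_Cons[OF n] by (simp add: assms(5) entry_ok_def)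
      have sw': "sw = word_elem n (block_word n ((n + 1, 0) # bs))"
        by (simp add: sw k_eq B_word_def h_word_def)
      have "minimal_in_coset n sw" unfolding sw' using minimal_block[OF n v'] .
      moreover have "affine_block n ((n + 1, 0) # bs)"
        using v' by (simp add: affine_block_iff_valid_block)
      moreover have "sw = block_elem n ((n + 1, 0) # bs)" using sw' by (simp add: block_elem_def)
      ultimately show ?thesis using True ext' by blast
    next
      case other
      have "letter_outcome n k bs"
        using affine_letter_outcome[OF n _ other] v unfolding k_eq assms(5) by blast
      moreover have "\<not> extremal n ?h" "?h \<noteq> \<one>\<^bsub>WA_aff n\<^esub>"
        using other n extremal_h_word_iff[OF n b1] h_word_trivial_iff[OF n b1] by auto
      ultimately show ?thesis using generic by blast
    qed
  qed
qed

end
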